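(* Fix $\beta_1\in\mathbb R$. For $\beta_2\in\mathbb R$ and a graphon $W$ let $T_\wedge(W)=\beta_1t(K_2,W)+\beta_2t_{\mathrm{ind}}(K_{1,2},W)$, and let $$\psi_\wedge(\beta_2)=\sup_{\widetilde W\in\widetilde{\mathcal W}}\Big\{T_\wedge(W)-\tfrac12\mathcal I(W)\Big\},\qquad \mathcal M^*_\wedge(\beta_2)=\operatorname*{arg\,max}_{\widetilde W\in\widetilde{\mathcal W}}\Big\{T_\wedge(W)-\tfrac12\mathcal I(W)\Big\}.$$ Then $$\lim_{\beta_2\to+\infty}\ \sup_{\widetilde W\in\mathcal M^*_\wedge(\beta_2)}\delta_\square(\widetilde W,\widetilde W_{\mathrm{bip}})=0,$$ where $\widetilde W_{\mathrm{bip}}$ is the equivalence class of the complete balanced bipartite graphon $W_{\mathrm{bip}}(x,y)=\mathbf 1\{(x,y)\in[0,\frac12]\times[\frac12,1]\}+\mathbf 1\{(x,y)\in[\frac12,1]\times[0,\frac12]\}$. Moreover, $$\lim_{\beta_2\to+\infty}\frac{\psi_\wedge(\beta_2)}{\beta_2}=\frac14 .$$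
   Context: A graphon is a measurable symmetric function $W:[0,1]^2\to[0,1]$. Cut distance: $\delta_\square(U,W)=\inf_\phi\sup_{S,T\subset[0,1]}|\int_{S\times T}(U(x,y)-W(\phi(x),\phi(y)))\,dx\,dy|$ over measure-preserving bijections $\phi$ of $[0,1]$. $\widetilde{\mathcal W}$ is the set of graphons modulo $\delta_\square=0$; $\widetilde W$ is the class of $W$. All functionals below depend only on the class. $t(K_2,W)=\int_{[0,1]^2}W(x,y)\,dx\,dy$; $t_{\mathrm{ind}}(K_{1,2},W)=\int_{[0,1]^3}W(x,y)W(x,z)(1-W(y,z))\,dx\,dy\,dz$; $\mathcal I(W)=\int_{[0,1]^2}\big[W\log W+(1-W)\log(1-W)\big]dx\,dy$ with $0\log0=0$. *)

theory Defs
  imports "HOL-Analysis.Analysis"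
begin

abbreviation unit_ivl :: "real set" ("\<I>") where "\<I> \<equiv> {0..1}"

(* Kernels are functions on all of R x R of which only the values on the unit square matter:
   kernels that agree there have cut distance 0. *)
definition graphon :: "(real \<Rightarrow> real \<Rightarrow> real) \<Rightarrow> bool" where
  "graphon W \<longleftrightarrow>
     (\<lambda>(x, y). W x y) \<in> borel_measurable (lebesgue_on (\<I> \<times> \<I>)) \<and>
     (\<forall>x\<in>\<I>. \<forall>y\<in>\<I>. W x y = W y x \<and> 0 \<le> W x y \<and> W x y \<le> 1)"

(* Inverses are again in this set: mp_bijections_inverse below. *)
definition mp_bijections :: "(real \<Rightarrow> real) set" where
  "mp_bijections = {\<phi>. bij_betw \<phi> \<I> \<I> \<and> \<phi> \<in> lebesgue_on \<I> \<rightarrow>\<^sub>M lebesgue_on \<I> \<and>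
                        distr (lebesgue_on \<I>) (lebesgue_on \<I>) \<phi> = lebesgue_on \<I>}"

abbreviation square_sets :: "(real set \<times> real set) set" where
  "square_sets \<equiv> {(S, T). S \<in> sets lebesgue \<and> S \<subseteq> \<I> \<and> T \<in> sets lebesgue \<and> T \<subseteq> \<I>}"

definition cut_norm :: "(real \<Rightarrow> real \<Rightarrow> real) \<Rightarrow> real" where
  "cut_norm f = (SUP (S, T) \<in> square_sets. \<bar>LINT (x, y):S \<times> T|lebesgue. f x y\<bar>)"

definition cut_dist :: "(real \<Rightarrow> real \<Rightarrow> real) \<Rightarrow> (real \<Rightarrow> real \<Rightarrow> real) \<Rightarrow> real" where
  "cut_dist U W = (INF \<phi> \<in> mp_bijections. cut_norm (\<lambda>x y. U x y - W (\<phi> x) (\<phi> y)))"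

definition edge_density :: "(real \<Rightarrow> real \<Rightarrow> real) \<Rightarrow> real" where
  "edge_density W = (LINT (x, y):\<I> \<times> \<I>|lebesgue. W x y)"

definition ind_wedge_density :: "(real \<Rightarrow> real \<Rightarrow> real) \<Rightarrow> real" where
  "ind_wedge_density W = (LINT (x, y, z):\<I> \<times> \<I> \<times> \<I>|lebesgue. W x y * W x z * (1 - W y z))"

(* HOL has ln 0 = 0, and in any case 0 * ln 0 = 0. *)
definition graphon_entropy :: "(real \<Rightarrow> real \<Rightarrow> real) \<Rightarrow> real" where
  "graphon_entropy W =
     (LINT (x, y):\<I> \<times> \<I>|lebesgue. W x y * ln (W x y) + (1 - W x y) * ln (1 - W x y))"

definition wedge_objective :: "real \<Rightarrow> real \<Rightarrow> (real \<Rightarrow> real \<Rightarrow> real) \<Rightarrow> real" where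
  "wedge_objective \<beta>1 \<beta>2 W =
     \<beta>1 * edge_density W + \<beta>2 * ind_wedge_density W - graphon_entropy W / 2"

definition graphon_rel :: "((real \<Rightarrow> real \<Rightarrow> real) \<times> (real \<Rightarrow> real \<Rightarrow> real)) set" where
  "graphon_rel = {(U, W). graphon U \<and> graphon W \<and> cut_dist U W = 0}"

definition graphon_space :: "(real \<Rightarrow> real \<Rightarrow> real) set set" where
  "graphon_space = {W. graphon W} // graphon_rel"

definition graphon_class :: "(real \<Rightarrow> real \<Rightarrow> real) \<Rightarrow> (real \<Rightarrow> real \<Rightarrow> real) set" where
  "graphon_class W = graphon_rel `` {W}"

(* For classes of graphons the infimum is over a singleton: class_dist_graphon_class below. *)
definition class_dist :: "(real \<Rightarrow> real \<Rightarrow> real) set \<Rightarrow> (real \<Rightarrow> real \<Rightarrow> real) set \<Rightarrow> real" where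
  "class_dist C D = (INF (U, W) \<in> C \<times> D. cut_dist U W)"

(* wedge_objective takes the same value on all members of a class, so the supremum over classes
   ranges over all members of all classes, and a class is a maximizer if one of its members is. *)
definition psi_wedge :: "real \<Rightarrow> real \<Rightarrow> real" where
  "psi_wedge \<beta>1 \<beta>2 = (SUP W \<in> \<Union> graphon_space. wedge_objective \<beta>1 \<beta>2 W)"

definition maximizers_wedge :: "real \<Rightarrow> real \<Rightarrow> (real \<Rightarrow> real \<Rightarrow> real) set set" where
  "maximizers_wedge \<beta>1 \<beta>2 =
     {C \<in> graphon_space. \<exists>W\<in>C. \<forall>U\<in>\<Union> graphon_space.
        wedge_objective \<beta>1 \<beta>2 U \<le> wedge_objective \<beta>1 \<beta>2 W}"

(* The sum of the two indicator functions, except at (1/2, 1/2), where that sum would be 2. *)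
definition W_bip :: "real \<Rightarrow> real \<Rightarrow> real" where
  "W_bip x y = indicator ({0..1/2} \<times> {1/2..1} \<union> {1/2..1} \<times> {0..1/2}) (x, y)"

lemma mp_bijections_inner:
  assumes "\<phi> \<in> mp_bijections" "A \<in> sets lebesgue" "A \<subseteq> \<I>" "e > 0"
  shows "\<exists>K. compact K \<and> K \<subseteq> \<phi> ` A \<and> emeasure lebesgue A \<le> emeasure lebesgue K + ennreal e"
proof -
  have bij: "bij_betw \<phi> \<I> \<I>" and meas: "\<phi> \<in> lebesgue_on \<I> \<rightarrow>\<^sub>M lebesgue_on \<I>"
    and dst: "distr (lebesgue_on \<I>) (lebesgue_on \<I>) \<phi> = lebesgue_on \<I>"
    using assms(1) by (auto simp: mp_bijections_def)
  define f where "f = (\<lambda>x. if x \<in> \<I> then \<phi> x else 0)"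
  have "\<phi> \<in> lebesgue_on \<I> \<rightarrow>\<^sub>M borel"
    using measurable_compose[OF meas id_borel_measurable_lebesgue_on[unfolded id_def]] by simp
  then have "f \<in> borel_measurable lebesgue"
    unfolding f_def by (subst borel_measurable_if) auto
  then obtain g where g[measurable]: "g \<in> borel_measurable lborel" and ae: "AE x in lborel. f x = g x"
    using completion_ex_borel_measurable_real by blast
  from ae obtain N where N: "N \<in> null_sets lborel" "{x. f x \<noteq> g x} \<subseteq> N"
    by (auto simp: eventually_ae_filter)
  from assms(2) obtain S N1 N2 where A: "A = S \<union> N1" "N1 \<subseteq> N2" "N2 \<in> null_sets lborel" "S \<in> sets lborel"
    by (rule sets_completionE)
  define B where "B = S - N"
  have [measurable]: "B \<in> sets borel" using A N unfolding B_def by auto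
  have BA: "B \<subseteq> A" using A B_def by auto
  have BI: "B \<subseteq> \<I>" using BA assms(3) by auto
  have fg: "\<phi> x = g x" if "x \<in> B" for x
  proof -
    have "x \<notin> N" "x \<in> \<I>" using that BI by (auto simp: B_def)
    then have "f x = g x" using N by auto
    with \<open>x \<in> \<I>\<close> show ?thesis by (simp add: f_def)
  qed
  have [measurable]: "N \<in> sets borel" "N2 \<in> sets borel" "S \<in> sets borel"
    using A N by (auto dest: null_setsD2)
  have "B \<union> (N \<union> N2) \<in> sets borel" by measurable
  then have "emeasure lebesgue A \<le> emeasure lebesgue (B \<union> (N \<union> N2))"
    using A N by (intro emeasure_mono) (auto simp: B_def)
  also have "\<dots> \<le> emeasure lebesgue B + emeasure lebesgue (N \<union> N2)"
    using A N by (intro emeasure_subadditive) auto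
  also have "emeasure lebesgue (N \<union> N2) = 0"
    using null_sets.Un[OF N(1) A(3)] by auto
  finally have leA: "emeasure lebesgue A \<le> emeasure lborel B" by simp
  define \<nu> where "\<nu> = distr (restrict_space lborel B) borel (\<lambda>x. (x, g x))"
  have m[measurable]: "(\<lambda>x. (x, g x)) \<in> restrict_space lborel B \<rightarrow>\<^sub>M borel"
    unfolding borel_prod[symmetric] by (intro measurable_restrict_space1) measurable
  have em\<nu>: "emeasure \<nu> X = emeasure lborel {x\<in>B. (x, g x) \<in> X}" if "X \<in> sets borel" for X
    unfolding \<nu>_def using that
    by (subst emeasure_distr) (auto simp: space_restrict_space emeasure_restrict_space intro!: arg_cong[where f="emeasure lborel"])
  have Bfin: "emeasure lborel B < \<infinity>"
  proof -
    have "emeasure lborel B \<le> emeasure lborel \<I>" using BI by (intro emeasure_mono) auto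
    then show ?thesis by (simp add: le_less_trans)
  qed
  define G where "G = {p. fst p \<in> B \<and> snd p = g (fst p)}"
  have "{p \<in> space (borel \<Otimes>\<^sub>M borel). fst p \<in> B \<and> snd p = g (fst p)} \<in> sets (borel \<Otimes>\<^sub>M (borel :: real measure))"
    by measurable
  then have Gm: "G \<in> sets borel"
    unfolding G_def borel_prod by (simp add: space_pair_measure)
  have \<nu>G: "emeasure \<nu> G = emeasure lborel B"
    using Gm by (subst em\<nu>) (auto simp: G_def intro!: arg_cong[where f="emeasure lborel"])
  have "emeasure \<nu> (space \<nu>) \<noteq> \<infinity>"
    using Bfin by (simp add: em\<nu> \<nu>_def[THEN arg_cong[where f=space]])
  then have reg: "emeasure \<nu> G = (SUP K \<in> {K. K \<subseteq> G \<and> compact K}. emeasure \<nu> K)"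
    using Gm by (intro inner_regular) (auto simp: \<nu>_def)
  have "\<exists>K0\<in>{K. K \<subseteq> G \<and> compact K}. emeasure lborel B \<le> emeasure \<nu> K0 + ennreal e"
  proof (cases "emeasure lborel B = 0")
    case True
    then show ?thesis by (intro bexI[of _ "{}"]) auto
  next
    case False
    then have "emeasure lborel B - ennreal e < emeasure lborel B"
      using Bfin assms(4) by (intro ennreal_between) (auto simp: zero_less_iff_neq_zero)
    then obtain K0 where "K0 \<in> {K. K \<subseteq> G \<and> compact K}" "emeasure lborel B - ennreal e < emeasure \<nu> K0"
      unfolding \<nu>G[symmetric] reg less_SUP_iff by auto
    then show ?thesis
      by (intro bexI[of _ K0]) (auto simp: ennreal_minus_le_iff add.commute dest!: less_imp_le)
  qed
  then obtain K0 where K0: "K0 \<subseteq> G" "compact K0" "emeasure lborel B \<le> emeasure \<nu> K0 + ennreal e"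
    by auto
  have K0b: "K0 \<in> sets borel" using K0 by (simp add: borel_compact)
  define K where "K = snd ` K0"
  have cK: "compact K" unfolding K_def using K0 by (intro compact_continuous_image continuous_intros)
  have KA: "K \<subseteq> \<phi> ` A"
    using K0(1) fg BA unfolding K_def G_def by force
  have KI: "K \<subseteq> \<I>" using KA assms(3) bij by (auto simp: bij_betw_def)
  have Kl: "K \<in> sets lebesgue" using cK by (simp add: borel_compact)
  have "emeasure \<nu> K0 = emeasure lebesgue {x\<in>B. (x, g x) \<in> K0}"
  proof -
    have "{x\<in>B. (x, g x) \<in> K0} \<in> sets borel"
    proof -
      have "(\<lambda>x. (x, g x)) \<in> borel \<rightarrow>\<^sub>M borel" unfolding borel_prod[symmetric] by measurable
      from measurable_sets[OF this K0b] show ?thesis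
        by (simp add: vimage_def) (metis Collect_conj_eq Collect_mem_eq \<open>B \<in> sets borel\<close> sets.Int)
    qed
    then show ?thesis using em\<nu>[OF K0b] by simp
  qed
  also have "\<dots> \<le> emeasure lebesgue (\<phi> -` K \<inter> \<I>)"
  proof (intro emeasure_mono)
    have "\<phi> -` K \<inter> space (lebesgue_on \<I>) \<in> sets (lebesgue_on \<I>)"
      using Kl KI by (intro measurable_sets[OF meas]) (auto simp: sets_restrict_space image_iff)
    then show "\<phi> -` K \<inter> \<I> \<in> sets lebesgue"
      by (auto simp: sets_restrict_space_iff)
    show "{x \<in> B. (x, g x) \<in> K0} \<subseteq> \<phi> -` K \<inter> \<I>"
      using fg BI unfolding K_def by force
  qed
  also have "\<dots> = emeasure (distr (lebesgue_on \<I>) (lebesgue_on \<I>) \<phi>) K"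
    using Kl KI by (subst emeasure_distr[OF meas]) (auto simp: sets_restrict_space image_iff emeasure_restrict_space)
  also have "\<dots> = emeasure lebesgue K"
    using KI Kl unfolding dst by (simp add: emeasure_restrict_space)
  finally show ?thesis
    using leA K0(3) cK KA by (intro exI[of _ K]) (auto intro: order_trans add_right_mono)
qed

lemma mp_bijections_vimage:
  assumes "\<phi> \<in> mp_bijections" "A \<in> sets lebesgue" "A \<subseteq> \<I>"
  shows "\<phi> -` A \<inter> \<I> \<in> sets lebesgue" "emeasure lebesgue (\<phi> -` A \<inter> \<I>) = emeasure lebesgue A"
proof -
  have meas: "\<phi> \<in> lebesgue_on \<I> \<rightarrow>\<^sub>M lebesgue_on \<I>"
    and dst: "distr (lebesgue_on \<I>) (lebesgue_on \<I>) \<phi> = lebesgue_on \<I>"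
    using assms(1) by (auto simp: mp_bijections_def)
  have A: "A \<in> sets (lebesgue_on \<I>)" using assms by (auto simp: sets_restrict_space image_iff)
  show "\<phi> -` A \<inter> \<I> \<in> sets lebesgue"
    using measurable_sets[OF meas A] by (auto simp: sets_restrict_space_iff)
  have "emeasure lebesgue (\<phi> -` A \<inter> \<I>) = emeasure (distr (lebesgue_on \<I>) (lebesgue_on \<I>) \<phi>) A"
    by (subst emeasure_distr[OF meas A]) (auto simp: emeasure_restrict_space)
  then show "emeasure lebesgue (\<phi> -` A \<inter> \<I>) = emeasure lebesgue A"
    using assms unfolding dst by (simp add: emeasure_restrict_space)
qed

lemma mp_bijections_image:
  assumes "\<phi> \<in> mp_bijections" "A \<in> sets lebesgue" "A \<subseteq> \<I>"
  shows "\<phi> ` A \<in> sets lebesgue" "emeasure lebesgue (\<phi> ` A) = emeasure lebesgue A"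
proof -
  have bij: "bij_betw \<phi> \<I> \<I>" using assms(1) by (auto simp: mp_bijections_def)
  have lm: "X \<in> lmeasurable" if "X \<in> sets lebesgue" "X \<subseteq> \<I>" for X
    using that by (intro bounded_set_imp_lmeasurable) (auto intro: bounded_subset[of \<I>])
  have inner: "\<exists>K. compact K \<and> K \<subseteq> \<phi> ` X \<and> measure lebesgue X \<le> measure lebesgue K + e"
    if X: "X \<in> sets lebesgue" "X \<subseteq> \<I>" "e > 0" for X e
  proof -
    obtain K where K: "compact K" "K \<subseteq> \<phi> ` X" "emeasure lebesgue X \<le> emeasure lebesgue K + ennreal e"
      using mp_bijections_inner[OF assms(1) X] by auto
    have "K \<in> lmeasurable" using K(1) by (rule lmeasurable_compact)
    with K(3) lm[OF X(1,2)] X(3) have "measure lebesgue X \<le> measure lebesgue K + e"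
      by (simp add: emeasure_eq_measure2 flip: ennreal_plus)
    with K show ?thesis by auto
  qed
  have "\<phi> ` A \<in> lmeasurable"
    unfolding completion.fmeasurable_inner_outer
  proof (intro allI impI)
    fix e :: real assume e: "0 < e"
    obtain K where K: "compact K" "K \<subseteq> \<phi> ` A" "measure lebesgue A \<le> measure lebesgue K + e/3"
      using inner[OF assms(2,3), of "e/3"] e by auto
    obtain L where L: "compact L" "L \<subseteq> \<phi> ` (\<I> - A)" "measure lebesgue (\<I> - A) \<le> measure lebesgue L + e/3"
      using inner[of "\<I> - A" "e/3"] sets.Diff[OF _ assms(2), of \<I>] e by auto
    have img: "\<phi> ` (\<I> - A) = \<I> - \<phi> ` A"
      using bij assms(3) by (auto simp: bij_betw_def inj_on_image_set_diff[of \<phi> \<I>])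
    have LI: "L \<subseteq> \<I>" using L img by auto
    have Ll: "L \<in> lmeasurable" using L(1) by (rule lmeasurable_compact)
    have "\<phi> ` A \<subseteq> \<I>" using assms(3) bij by (auto simp: bij_betw_def)
    then have KL: "K \<subseteq> \<I> - L" using K L img by blast
    have Kl: "K \<in> lmeasurable" using K(1) by (rule lmeasurable_compact)
    have m1: "measure lebesgue (\<I> - A) = 1 - measure lebesgue A"
      using assms lm[OF assms(2,3)] by (subst measurable_measure_Diff) auto
    have m2: "measure lebesgue (\<I> - L) = 1 - measure lebesgue L"
      using LI Ll by (subst measurable_measure_Diff) auto
    have "measure lebesgue K \<le> measure lebesgue (\<I> - L)"
      using KL Kl Ll by (intro measure_mono_fmeasurable) auto
    then have "\<bar>measure lebesgue K - measure lebesgue (\<I> - L)\<bar> < e"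
      using K(3) L(3) m1 m2 e by (auto simp: abs_if)
    moreover have "\<phi> ` A \<subseteq> \<I> - L" using L img \<open>\<phi> ` A \<subseteq> \<I>\<close> by blast
    ultimately show "\<exists>T\<in>lmeasurable. \<exists>U\<in>lmeasurable. T \<subseteq> \<phi> ` A \<and> \<phi> ` A \<subseteq> U \<and> \<bar>measure lebesgue T - measure lebesgue U\<bar> < e"
      using K Kl Ll by (intro bexI[of _ K] bexI[of _ "\<I> - L"]) auto
  qed
  then show 1: "\<phi> ` A \<in> sets lebesgue" by auto
  have "\<phi> ` A \<subseteq> \<I>" using bij assms(3) by (auto simp: bij_betw_def)
  have "\<phi> x \<in> \<phi> ` A \<longleftrightarrow> x \<in> A" if "x \<in> \<I>" for x
    using bij inj_on_image_mem_iff[OF _ that assms(3)] by (auto simp: bij_betw_def)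
  then have "\<phi> -` (\<phi> ` A) \<inter> \<I> = A" using assms(3) by blast
  with \<open>\<phi> ` A \<subseteq> \<I>\<close> mp_bijections_vimage(2)[OF assms(1) 1] show "emeasure lebesgue (\<phi> ` A) = emeasure lebesgue A"
    by simp
qed

lemma mp_bijectionsI:
  assumes "bij_betw \<phi> \<I> \<I>"
    "\<And>A. A \<in> sets lebesgue \<Longrightarrow> A \<subseteq> \<I> \<Longrightarrow> \<phi> -` A \<inter> \<I> \<in> sets lebesgue"
    "\<And>A. A \<in> sets lebesgue \<Longrightarrow> A \<subseteq> \<I> \<Longrightarrow> emeasure lebesgue (\<phi> -` A \<inter> \<I>) = emeasure lebesgue A"
  shows "\<phi> \<in> mp_bijections"
proof -
  have s: "A \<in> sets (lebesgue_on \<I>) \<longleftrightarrow> A \<in> sets lebesgue \<and> A \<subseteq> \<I>" for A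
    by (auto simp: sets_restrict_space_iff)
  have m: "\<phi> \<in> lebesgue_on \<I> \<rightarrow>\<^sub>M lebesgue_on \<I>"
    using assms by (intro measurableI) (auto simp: s bij_betw_def)
  have "distr (lebesgue_on \<I>) (lebesgue_on \<I>) \<phi> = lebesgue_on \<I>"
    using assms by (intro measure_eqI) (auto simp: emeasure_distr[OF m] s emeasure_restrict_space)
  with m assms show ?thesis by (simp add: mp_bijections_def)
qed

lemma mp_bijections_id: "(\<lambda>x. x) \<in> mp_bijections"
  by (intro mp_bijectionsI) (auto simp: bij_betw_def Int_absorb2)

lemma mp_bijections_compose:
  assumes "\<phi> \<in> mp_bijections" "\<psi> \<in> mp_bijections"
  shows "(\<lambda>x. \<psi> (\<phi> x)) \<in> mp_bijections"
proof -
  have b: "bij_betw \<phi> \<I> \<I>" "bij_betw \<psi> \<I> \<I>" using assms by (auto simp: mp_bijections_def)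
  have v: "(\<lambda>x. \<psi> (\<phi> x)) -` A \<inter> \<I> = \<phi> -` (\<psi> -` A \<inter> \<I>) \<inter> \<I>" for A
    using b by (auto simp: bij_betw_def)
  show ?thesis
    by (intro mp_bijectionsI)
       (use b assms in \<open>auto simp: v mp_bijections_vimage simp del: emeasure_completion vimage_Int intro: bij_betw_trans[of \<phi> \<I> \<I> \<psi> \<I>, unfolded comp_def]\<close>)
qed

lemma mp_bijections_inverse:
  assumes "\<phi> \<in> mp_bijections"
  shows "the_inv_into \<I> \<phi> \<in> mp_bijections"
proof -
  have b: "bij_betw \<phi> \<I> \<I>" using assms by (auto simp: mp_bijections_def)
  have v: "the_inv_into \<I> \<phi> -` A \<inter> \<I> = \<phi> ` A" if "A \<subseteq> \<I>" for A
  proof (intro set_eqI iffI)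
    fix y assume "y \<in> the_inv_into \<I> \<phi> -` A \<inter> \<I>"
    then show "y \<in> \<phi> ` A" using b f_the_inv_into_f[of \<phi> \<I> y] by (force simp: bij_betw_def)
  next
    fix y assume "y \<in> \<phi> ` A"
    then show "y \<in> the_inv_into \<I> \<phi> -` A \<inter> \<I>"
      using b that by (auto simp: bij_betw_def the_inv_into_f_f subset_iff)
  qed
  show ?thesis
    by (intro mp_bijectionsI)
       (use b assms in \<open>auto simp: v mp_bijections_image simp del: emeasure_completion intro: bij_betw_the_inv_into\<close>)
qed

lemma lebesgue_Times:
  fixes A B :: "real set"
  assumes "A \<in> sets lebesgue" "B \<in> sets lebesgue"
  shows "A \<times> B \<in> sets lebesgue"
    "emeasure lebesgue (A \<times> B) = emeasure lebesgue A * emeasure lebesgue B"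
proof -
  obtain S N N' where A: "A = S \<union> N" "N \<subseteq> N'" "N' \<in> null_sets lborel" "S \<in> sets lborel"
    using assms(1) by (rule sets_completionE)
  obtain T M M' where B: "B = T \<union> M" "M \<subseteq> M'" "M' \<in> null_sets lborel" "T \<in> sets lborel"
    using assms(2) by (rule sets_completionE)
  have *: "emeasure lborel (X \<times> Y) = emeasure lborel X * emeasure lborel Y"
    if "X \<in> sets lborel" "Y \<in> sets lborel" for X Y :: "real set"
    using that by (subst lborel_prod[symmetric], subst lborel.emeasure_pair_measure_Times) auto
  have sP: "X \<times> Y \<in> sets lborel" if "X \<in> sets lborel" "Y \<in> sets lborel" for X Y :: "real set"
    using that by (subst lborel_prod[symmetric]) auto
  define Z where "Z = N' \<times> UNIV \<union> UNIV \<times> M'"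
  have Z: "Z \<in> null_sets lborel"
  proof -
    have s: "N' \<in> sets lborel" "M' \<in> sets lborel" using A(3) B(3) by (auto dest: null_setsD2)
    have "emeasure lborel N' = 0" "emeasure lborel M' = 0" using A(3) B(3) by (auto dest: null_setsD1)
    then show ?thesis unfolding Z_def using s
      by (intro null_sets.Un null_setsI sP) (auto simp: *)
  qed
  have e: "A \<times> B = S \<times> T \<union> (A \<times> B - S \<times> T)" "A \<times> B - S \<times> T \<subseteq> Z"
    using A B unfolding Z_def by auto
  have ST: "S \<times> T \<in> sets lborel" using A B sP by auto
  show AB: "A \<times> B \<in> sets lebesgue"
    using e Z ST by (rule sets_completionI)
  have n: "A \<times> B - S \<times> T \<in> null_sets lebesgue"
    using null_sets_completion_subset[OF e(2) null_sets_completionI[OF Z]] .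
  have "emeasure lebesgue (A \<times> B) = emeasure lebesgue (S \<times> T)"
    using n ST by (subst e(1), subst emeasure_Un_null_set) auto
  also have "\<dots> = emeasure lborel S * emeasure lborel T" using A B ST * by simp
  also have "emeasure lborel S = emeasure lebesgue A"
    using A null_sets_completion_subset[OF A(2) null_sets_completionI[OF A(3)]] by (simp add: emeasure_Un_null_set del: emeasure_completion) simp
  also have "emeasure lborel T = emeasure lebesgue B"
    using B null_sets_completion_subset[OF B(2) null_sets_completionI[OF B(3)]] by (simp add: emeasure_Un_null_set del: emeasure_completion) simp
  finally show "emeasure lebesgue (A \<times> B) = emeasure lebesgue A * emeasure lebesgue B" .
qed

lemma mp_bijections_square:
  assumes "\<phi> \<in> mp_bijections"
  defines "\<Phi> \<equiv> \<lambda>(x, y). (\<phi> x, \<phi> y)"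
  shows "\<Phi> \<in> lebesgue_on (\<I> \<times> \<I>) \<rightarrow>\<^sub>M lebesgue_on (\<I> \<times> \<I>)"
    "distr (lebesgue_on (\<I> \<times> \<I>)) (lebesgue_on (\<I> \<times> \<I>)) \<Phi> = lebesgue_on (\<I> \<times> \<I>)"
proof -
  let ?M = "lebesgue_on \<I>" and ?L = "lebesgue_on (\<I> \<times> \<I>)"
  have bij: "bij_betw \<phi> \<I> \<I>" and meas: "\<phi> \<in> ?M \<rightarrow>\<^sub>M ?M" and dst: "distr ?M ?M \<phi> = ?M"
    using assms(1) by (auto simp: mp_bijections_def)
  interpret M: finite_measure ?M by (rule finite_measure_lebesgue_on) auto
  interpret MM: pair_sigma_finite ?M ?M ..
  define P where "P = ?M \<Otimes>\<^sub>M ?M"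
  have II: "\<I> \<times> \<I> \<in> sets lebesgue" by (intro lebesgue_Times) auto
  have sM: "A \<in> sets ?M \<longleftrightarrow> A \<in> sets lebesgue \<and> A \<subseteq> \<I>" for A
    by (auto simp: sets_restrict_space_iff)
  have sL: "A \<in> sets ?L \<longleftrightarrow> A \<in> sets lebesgue \<and> A \<subseteq> \<I> \<times> \<I>" for A
    using II by (auto simp: sets_restrict_space_iff)
  have eL: "emeasure ?L A = emeasure lebesgue A" if "A \<in> sets ?L" for A
    using that II by (auto simp: sL emeasure_restrict_space simp del: emeasure_completion)
  have spP: "space P = \<I> \<times> \<I>" by (simp add: P_def space_pair_measure)
  have id1: "(\<lambda>p. p) \<in> ?L \<rightarrow>\<^sub>M P"
    unfolding P_def
  proof (rule measurable_pair_measureI)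
    show "(\<lambda>p. p) \<in> space ?L \<rightarrow> space ?M \<times> space ?M" by auto
    fix A B assume "A \<in> sets ?M" "B \<in> sets ?M"
    then have "A \<times> B \<in> sets ?L" by (auto simp: sM sL lebesgue_Times)
    then show "(\<lambda>p. p) -` (A \<times> B) \<inter> space ?L \<in> sets ?L"
      by (simp add: sL Int_absorb2)
  qed
  have PL: "X \<in> sets ?L" if "X \<in> sets P" for X
    using measurable_sets[OF id1 that] sets.sets_into_space[OF that] spP by (simp add: Int_absorb2)
  have Peq: "P = distr ?L P (\<lambda>p. p)"
    unfolding P_def
  proof (rule pair_measure_eqI)
    show "sigma_finite_measure ?M" "sigma_finite_measure ?M" by unfold_locales
    show "sets (?M \<Otimes>\<^sub>M ?M) = sets (distr ?L (?M \<Otimes>\<^sub>M ?M) (\<lambda>p. p))" by simp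
    fix A B assume AB: "A \<in> sets ?M" "B \<in> sets ?M"
    then have "A \<times> B \<in> sets ?L" by (auto simp: sM sL lebesgue_Times)
    with AB show "emeasure ?M A * emeasure ?M B = emeasure (distr ?L (?M \<Otimes>\<^sub>M ?M) (\<lambda>p. p)) (A \<times> B)"
      using id1 by (subst emeasure_distr)
        (auto simp: P_def sM sL Int_absorb2 emeasure_restrict_space lebesgue_Times II simp del: emeasure_completion)
  qed
  have eP: "emeasure P X = emeasure lebesgue X" if "X \<in> sets P" for X
  proof -
    have "emeasure P X = emeasure (distr ?L P (\<lambda>p. p)) X" using Peq by simp
    also have "\<dots> = emeasure lebesgue X"
      using PL[OF that] eL[OF PL[OF that]] by (subst emeasure_distr[OF id1 that]) (simp add: sL Int_absorb2 del: emeasure_completion)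
    finally show ?thesis .
  qed
  have \<Phi>P: "\<Phi> \<in> P \<rightarrow>\<^sub>M P"
    unfolding \<Phi>_def P_def using meas by measurable
  have "P = distr P P \<Phi>"
    using pair_measure_distr[OF meas meas] unfolding dst P_def \<Phi>_def
    by (simp add: M.sigma_finite_measure_axioms)
  then have \<Phi>e: "emeasure P (\<Phi> -` X \<inter> \<I> \<times> \<I>) = emeasure P X" if "X \<in> sets P" for X
    using emeasure_distr[OF \<Phi>P that] spP by simp
  have borelP: "X \<inter> \<I> \<times> \<I> \<in> sets P" if "X \<in> sets lborel" for X
  proof -
    have "(\<lambda>p. p) \<in> P \<rightarrow>\<^sub>M (borel :: (real \<times> real) measure)"
      unfolding borel_prod[symmetric] P_def
      by (intro measurable_pair)
         (auto simp: comp_def intro!: measurable_compose[OF measurable_fst] measurable_compose[OF measurable_snd]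
            id_borel_measurable_lebesgue_on[unfolded id_def])
    from measurable_sets[OF this, of X] that spP show ?thesis by simp
  qed
  have bI: "\<Phi> p \<in> \<I> \<times> \<I>" if "p \<in> \<I> \<times> \<I>" for p
    using that bij by (auto simp: \<Phi>_def bij_betw_def)
  have key: "\<Phi> -` A \<inter> \<I> \<times> \<I> \<in> sets ?L \<and> emeasure lebesgue (\<Phi> -` A \<inter> \<I> \<times> \<I>) = emeasure lebesgue A"
    if A: "A \<in> sets ?L" for A
  proof -
    have "A \<in> sets (completion lborel)" "A \<subseteq> \<I> \<times> \<I>" using A by (auto simp: sL)
    then obtain S N N' where S: "A = S \<union> N" "N \<subseteq> N'" "N' \<in> null_sets lborel" "S \<in> sets lborel"
      by (elim sets_completionE)
    define Z where "Z = N' \<inter> \<I> \<times> \<I>"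
    have SP: "S \<in> sets P" using borelP[OF S(4)] S(1) \<open>A \<subseteq> _\<close> by (simp add: Int_absorb2)
    have ZP: "Z \<in> sets P" using borelP S(3) unfolding Z_def by auto
    have Z0: "emeasure P Z = 0"
    proof -
      have "emeasure lebesgue Z \<le> emeasure lebesgue N'"
        using S(3) by (intro emeasure_mono) (auto simp: Z_def)
      also have "\<dots> = 0" using S(3) null_setsD1 null_sets_completionI by blast
      finally show ?thesis using eP[OF ZP] by simp
    qed
    have NZ: "N \<subseteq> Z" using S \<open>A \<subseteq> _\<close> by (auto simp: Z_def)
    let ?v = "\<lambda>X. \<Phi> -` X \<inter> \<I> \<times> \<I>"
    have vP: "?v X \<in> sets P" if "X \<in> sets P" for X
      using measurable_sets[OF \<Phi>P that] spP by simp
    have nn: "X \<in> null_sets lebesgue" if "X \<in> sets P" "emeasure P X = 0" for X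
      using that PL[OF that(1)] eP[OF that(1)] by (auto simp: sL intro!: null_setsI simp del: emeasure_completion)
    have vN: "?v N \<in> null_sets lebesgue"
    proof (rule completion.complete2)
      show "?v Z \<in> null_sets lebesgue" using nn vP[OF ZP] \<Phi>e[OF ZP] Z0 by auto
      show "?v N \<subseteq> ?v Z" using NZ by auto
    qed
    have N0: "N \<in> null_sets lebesgue" by (rule null_sets_completion_subset[OF S(2) null_sets_completionI[OF S(3)]])
    have vA: "?v A = ?v S \<union> ?v N" using S by auto
    have vS: "?v S \<in> sets lebesgue" "S \<in> sets lebesgue" using PL[OF vP[OF SP]] PL[OF SP] by (auto simp: sL)
    have "?v A \<in> sets lebesgue" unfolding vA using vS vN by auto
    moreover have "emeasure lebesgue (?v A) = emeasure lebesgue (?v S)"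
      unfolding vA using vS vN by (rule_tac emeasure_Un_null_set)
    moreover have "emeasure lebesgue A = emeasure lebesgue S"
      unfolding S(1) using vS N0 by (rule_tac emeasure_Un_null_set)
    moreover have "emeasure lebesgue (?v S) = emeasure lebesgue S"
      using eP[OF vP[OF SP]] eP[OF SP] \<Phi>e[OF SP] by simp
    ultimately show ?thesis by (auto simp: sL)
  qed
  show m: "\<Phi> \<in> ?L \<rightarrow>\<^sub>M ?L"
    using key bI by (intro measurableI) auto
  show "distr ?L ?L \<Phi> = ?L"
    using key by (intro measure_eqI) (auto simp: emeasure_distr[OF m] eL simp del: emeasure_completion)
qed

definition bounded_kernel :: "(real \<Rightarrow> real \<Rightarrow> real) \<Rightarrow> bool" where
  "bounded_kernel f \<longleftrightarrow> (\<lambda>(x, y). f x y) \<in> borel_measurable (lebesgue_on (\<I> \<times> \<I>)) \<and>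
     (\<exists>c. \<forall>x\<in>\<I>. \<forall>y\<in>\<I>. \<bar>f x y\<bar> \<le> c)"

lemma bounded_kernel_graphon: "graphon W \<Longrightarrow> bounded_kernel W"
  unfolding graphon_def bounded_kernel_def by (auto intro!: exI[of _ 1] simp: abs_le_iff order_trans[of _ 0])

lemma bounded_kernel_diff:
  assumes "bounded_kernel f" "bounded_kernel g"
  shows "bounded_kernel (\<lambda>x y. f x y - g x y)"
proof -
  obtain c d where "\<forall>x\<in>\<I>. \<forall>y\<in>\<I>. \<bar>f x y\<bar> \<le> c" "\<forall>x\<in>\<I>. \<forall>y\<in>\<I>. \<bar>g x y\<bar> \<le> d"
    using assms by (auto simp: bounded_kernel_def)
  then have "\<forall>x\<in>\<I>. \<forall>y\<in>\<I>. \<bar>f x y - g x y\<bar> \<le> c + d"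
    by (metis abs_triangle_ineq4 add_mono order_trans)
  moreover have "(\<lambda>p. case_prod f p - case_prod g p) \<in> borel_measurable (lebesgue_on (\<I> \<times> \<I>))"
    using assms by (intro borel_measurable_diff) (auto simp: bounded_kernel_def)
  moreover have "(\<lambda>p. case_prod f p - case_prod g p) = (\<lambda>(x, y). f x y - g x y)" by auto
  ultimately show ?thesis by (auto simp: bounded_kernel_def)
qed

lemma bounded_kernel_comp:
  assumes "bounded_kernel f" "\<phi> \<in> mp_bijections"
  shows "bounded_kernel (\<lambda>x y. f (\<phi> x) (\<phi> y))"
proof -
  have "\<phi> x \<in> \<I>" if "x \<in> \<I>" for x using assms(2) that by (auto simp: mp_bijections_def bij_betw_def)
  moreover have "(\<lambda>p. case_prod f (case p of (x, y) \<Rightarrow> (\<phi> x, \<phi> y))) \<in> borel_measurable (lebesgue_on (\<I> \<times> \<I>))"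
    using measurable_compose[OF mp_bijections_square(1)[OF assms(2)]] assms(1)
    by (auto simp: bounded_kernel_def)
  moreover have "(\<lambda>p. case_prod f (case p of (x, y) \<Rightarrow> (\<phi> x, \<phi> y))) = (\<lambda>(x, y). f (\<phi> x) (\<phi> y))" by auto
  ultimately show ?thesis using assms(1) unfolding bounded_kernel_def by metis
qed

lemma unit_square_lmeasurable: "\<I> \<times> \<I> \<in> lmeasurable"
  using lebesgue_Times[of \<I> \<I>] by (auto simp: fmeasurable_def)

lemma set_integral_square:
  fixes F :: "real \<times> real \<Rightarrow> real"
  assumes "A \<subseteq> \<I> \<times> \<I>"
  shows "set_lebesgue_integral lebesgue A F = (LINT p|lebesgue_on (\<I> \<times> \<I>). indicator A p * F p)"
  unfolding set_lebesgue_integral_def using unit_square_lmeasurable assms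
  by (subst integral_restrict_space) (auto intro!: Bochner_Integration.integral_cong simp: set_lebesgue_integral_def indicator_def)

lemma bounded_kernel_integrable:
  assumes "bounded_kernel f" "(S, T) \<in> square_sets"
  shows "integrable (lebesgue_on (\<I> \<times> \<I>)) (\<lambda>p. indicator (S \<times> T) p * case_prod f p)"
proof -
  interpret finite_measure "lebesgue_on (\<I> \<times> \<I>)"
    by (rule finite_measure_lebesgue_on) (rule unit_square_lmeasurable)
  obtain c where "\<forall>x\<in>\<I>. \<forall>y\<in>\<I>. \<bar>f x y\<bar> \<le> c" using assms by (auto simp: bounded_kernel_def)
  then have c: "\<bar>case_prod f p\<bar> \<le> c" if "p \<in> \<I> \<times> \<I>" for p using that by auto
  have "S \<times> T \<in> sets (lebesgue_on (\<I> \<times> \<I>))"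
    using assms(2) unit_square_lmeasurable by (auto simp: sets_restrict_space_iff lebesgue_Times)
  then have [measurable]: "indicator (S \<times> T) \<in> borel_measurable (lebesgue_on (\<I> \<times> \<I>))"
    by measurable
  have [measurable]: "case_prod f \<in> borel_measurable (lebesgue_on (\<I> \<times> \<I>))"
    using assms by (simp add: bounded_kernel_def)
  show ?thesis
  proof (rule integrable_const_bound[of _ c])
    show "AE p in lebesgue_on (\<I> \<times> \<I>). norm (indicator (S \<times> T) p * case_prod f p) \<le> c"
    proof (rule AE_I2)
      fix p assume "p \<in> space (lebesgue_on (\<I> \<times> \<I>))"
      then have "\<bar>case_prod f p\<bar> \<le> c" using c by auto
      then show "norm (indicator (S \<times> T) p * case_prod f p) \<le> c"
        by (cases "p \<in> S \<times> T") auto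
    qed
  qed measurable
qed

lemma square_sets_subset: "(S, T) \<in> square_sets \<Longrightarrow> S \<times> T \<subseteq> \<I> \<times> \<I>"
  by auto

lemma cut_norm_upper:
  assumes "bounded_kernel f" "(S, T) \<in> square_sets"
  shows "\<bar>LINT (x, y):S \<times> T|lebesgue. f x y\<bar> \<le> cut_norm f"
proof -
  interpret finite_measure "lebesgue_on (\<I> \<times> \<I>)"
    by (rule finite_measure_lebesgue_on) (rule unit_square_lmeasurable)
  obtain c where "\<forall>x\<in>\<I>. \<forall>y\<in>\<I>. \<bar>f x y\<bar> \<le> c" using assms by (auto simp: bounded_kernel_def)
  then have c: "\<bar>case_prod f p\<bar> \<le> c" if "p \<in> \<I> \<times> \<I>" for p using that by auto
  have "bdd_above ((\<lambda>(S, T). \<bar>LINT (x, y):S \<times> T|lebesgue. f x y\<bar>) ` square_sets)"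
  proof (rule bdd_aboveI2, clarify)
    fix S T assume "S \<in> sets lebesgue" "S \<subseteq> \<I>" "T \<in> sets lebesgue" "T \<subseteq> \<I>"
    then have ST: "(S, T) \<in> square_sets" by auto
    have "\<bar>LINT p|lebesgue_on (\<I> \<times> \<I>). indicator (S \<times> T) p * case_prod f p\<bar>
        \<le> (LINT p|lebesgue_on (\<I> \<times> \<I>). \<bar>indicator (S \<times> T) p * case_prod f p\<bar>)"
      by (rule integral_abs_bound)
    also have "\<dots> \<le> (LINT p|lebesgue_on (\<I> \<times> \<I>). c)"
    proof (rule integral_mono)
      show "integrable (lebesgue_on (\<I> \<times> \<I>)) (\<lambda>p. \<bar>indicator (S \<times> T) p * case_prod f p\<bar>)"
        using bounded_kernel_integrable[OF assms(1) ST] by (rule integrable_abs)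
      fix p assume "p \<in> space (lebesgue_on (\<I> \<times> \<I>))"
      then have "\<bar>case_prod f p\<bar> \<le> c" using c by auto
      then show "\<bar>indicator (S \<times> T) p * case_prod f p\<bar> \<le> c"
        by (cases "p \<in> S \<times> T") auto
    qed simp
    finally show "\<bar>LINT (x, y):S \<times> T|lebesgue. f x y\<bar> \<le> (LINT p|lebesgue_on (\<I> \<times> \<I>). c)"
      using set_integral_square[OF square_sets_subset[OF ST], of "case_prod f"] by simp
  qed
  from cSUP_upper[OF assms(2) this] show ?thesis by (simp add: cut_norm_def)
qed

lemma cut_norm_least:
  assumes "\<And>S T. (S, T) \<in> square_sets \<Longrightarrow> \<bar>LINT (x, y):S \<times> T|lebesgue. f x y\<bar> \<le> b"
  shows "cut_norm f \<le> b"
  unfolding cut_norm_def using assms by (intro cSUP_least) (auto intro: exI[of _ "{}"])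

lemma cut_norm_nonneg: "bounded_kernel f \<Longrightarrow> 0 \<le> cut_norm f"
  using cut_norm_upper[of f "{}" "{}"] by auto

lemma set_integral_kernel_diff:
  assumes "bounded_kernel f" "bounded_kernel g" "(S, T) \<in> square_sets"
  shows "(LINT (x, y):S \<times> T|lebesgue. f x y - g x y) =
    (LINT (x, y):S \<times> T|lebesgue. f x y) - (LINT (x, y):S \<times> T|lebesgue. g x y)"
proof -
  note sq = set_integral_square[OF square_sets_subset[OF assms(3)]]
  have "(LINT (x, y):S \<times> T|lebesgue. f x y - g x y) =
    (LINT p|lebesgue_on (\<I> \<times> \<I>). indicator (S \<times> T) p * case_prod f p - indicator (S \<times> T) p * case_prod g p)"
    unfolding sq by (intro Bochner_Integration.integral_cong) (auto simp: right_diff_distrib)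
  also have "\<dots> = (LINT p|lebesgue_on (\<I> \<times> \<I>). indicator (S \<times> T) p * case_prod f p) -
      (LINT p|lebesgue_on (\<I> \<times> \<I>). indicator (S \<times> T) p * case_prod g p)"
    using assms by (intro Bochner_Integration.integral_diff bounded_kernel_integrable)
  finally show ?thesis unfolding sq .
qed

lemma cut_norm_triangle:
  assumes "bounded_kernel f" "bounded_kernel g" "bounded_kernel h"
  shows "cut_norm (\<lambda>x y. f x y - h x y) \<le>
    cut_norm (\<lambda>x y. f x y - g x y) + cut_norm (\<lambda>x y. g x y - h x y)"
proof (rule cut_norm_least)
  fix S T assume ST: "(S, T) \<in> square_sets"
  show "\<bar>LINT (x, y):S \<times> T|lebesgue. f x y - h x y\<bar> \<le>
    cut_norm (\<lambda>x y. f x y - g x y) + cut_norm (\<lambda>x y. g x y - h x y)"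
    using cut_norm_upper[OF bounded_kernel_diff[OF assms(1,2)] ST]
      cut_norm_upper[OF bounded_kernel_diff[OF assms(2,3)] ST]
    unfolding set_integral_kernel_diff[OF assms(1,2) ST] set_integral_kernel_diff[OF assms(2,3) ST]
      set_integral_kernel_diff[OF assms(1,3) ST] by linarith
qed

lemma cut_norm_cong:
  assumes "\<And>x y. x \<in> \<I> \<Longrightarrow> y \<in> \<I> \<Longrightarrow> f x y = g x y"
  shows "cut_norm f = cut_norm g"
proof -
  have "(LINT (x, y):S \<times> T|lebesgue. f x y) = (LINT (x, y):S \<times> T|lebesgue. g x y)"
    if "(S, T) \<in> square_sets" for S T
    unfolding set_integral_square[OF square_sets_subset[OF that]]
    using assms by (intro Bochner_Integration.integral_cong) auto
  then show ?thesis unfolding cut_norm_def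
    by (intro arg_cong[where f=Sup] image_cong) auto
qed

lemma cut_norm_commute: "cut_norm (\<lambda>x y. f x y - g x y) = cut_norm (\<lambda>x y. g x y - f x y)"
proof -
  have "(LINT (x, y):S \<times> T|lebesgue. f x y - g x y) = - (LINT (x, y):S \<times> T|lebesgue. g x y - f x y)" for S T
  proof -
    have "(LINT (x, y):S \<times> T|lebesgue. f x y - g x y) =
        (LINT p|lebesgue. - (indicator (S \<times> T) p *\<^sub>R (case p of (x, y) \<Rightarrow> g x y - f x y)))"
      unfolding set_lebesgue_integral_def
      by (intro Bochner_Integration.integral_cong) (auto simp: indicator_def)
    then show ?thesis by (simp add: set_lebesgue_integral_def)
  qed
  then show ?thesis unfolding cut_norm_def by simp
qed

lemma set_integral_mp_bijection:
  assumes "bounded_kernel f" "\<phi> \<in> mp_bijections" "(S, T) \<in> square_sets"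
  shows "(LINT (x, y):S \<times> T|lebesgue. f (\<phi> x) (\<phi> y)) = (LINT (x, y):\<phi> ` S \<times> \<phi> ` T|lebesgue. f x y)"
    "(\<phi> ` S, \<phi> ` T) \<in> square_sets"
proof -
  let ?L = "lebesgue_on (\<I> \<times> \<I>)" and ?\<Phi> = "\<lambda>(x, y). (\<phi> x, \<phi> y)"
  have bij: "bij_betw \<phi> \<I> \<I>" using assms(2) by (auto simp: mp_bijections_def)
  show img: "(\<phi> ` S, \<phi> ` T) \<in> square_sets"
    using assms(2,3) bij by (auto simp: bij_betw_def mp_bijections_image)
  have inj: "\<phi> x \<in> \<phi> ` A \<longleftrightarrow> x \<in> A" if "x \<in> \<I>" "A \<subseteq> \<I>" for x A
    using bij inj_on_image_mem_iff[OF _ that] by (auto simp: bij_betw_def)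
  let ?G = "\<lambda>p. indicator (\<phi> ` S \<times> \<phi> ` T) p * case_prod f p"
  have "(LINT (x, y):S \<times> T|lebesgue. f (\<phi> x) (\<phi> y)) = (LINT p|?L. ?G (?\<Phi> p))"
    unfolding set_integral_square[OF square_sets_subset[OF assms(3)]]
  proof (intro Bochner_Integration.integral_cong refl)
    fix p assume "p \<in> space ?L"
    then obtain x y where p: "p = (x, y)" "x \<in> \<I>" "y \<in> \<I>" by auto
    have "indicator (\<phi> ` S) (\<phi> x) = (indicator S x :: real)" "indicator (\<phi> ` T) (\<phi> y) = (indicator T y :: real)"
      using inj[OF p(2)] inj[OF p(3)] assms(3) by (auto simp only: indicator_def mem_Collect_eq case_prod_conv)
    then show "indicator (S \<times> T) p * (case p of (x, y) \<Rightarrow> f (\<phi> x) (\<phi> y)) = ?G (?\<Phi> p)"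
      by (simp add: p(1) indicator_times)
  qed
  also have "\<dots> = integral\<^sup>L (distr ?L ?L ?\<Phi>) ?G"
    using mp_bijections_square(1)[OF assms(2)] bounded_kernel_integrable[OF assms(1) img]
    by (subst integral_distr) auto
  also have "\<dots> = (LINT (x, y):\<phi> ` S \<times> \<phi> ` T|lebesgue. f x y)"
    unfolding mp_bijections_square(2)[OF assms(2)] set_integral_square[OF square_sets_subset[OF img]] ..
  finally show "(LINT (x, y):S \<times> T|lebesgue. f (\<phi> x) (\<phi> y)) = (LINT (x, y):\<phi> ` S \<times> \<phi> ` T|lebesgue. f x y)" .
qed

lemma cut_norm_mp_bijection_le:
  assumes "bounded_kernel f" "\<phi> \<in> mp_bijections"
  shows "cut_norm (\<lambda>x y. f (\<phi> x) (\<phi> y)) \<le> cut_norm f"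
  using assms set_integral_mp_bijection[OF assms] cut_norm_upper[OF assms(1)]
  by (intro cut_norm_least) auto

lemma cut_norm_overlay_nonneg:
  assumes "graphon U" "graphon W" "\<phi> \<in> mp_bijections"
  shows "0 \<le> cut_norm (\<lambda>x y. U x y - W (\<phi> x) (\<phi> y))"
  by (rule cut_norm_nonneg[OF bounded_kernel_diff[OF bounded_kernel_graphon[OF assms(1)]
        bounded_kernel_comp[OF bounded_kernel_graphon[OF assms(2)] assms(3)]]])

lemma cut_dist_bdd_below:
  assumes "graphon U" "graphon W"
  shows "bdd_below ((\<lambda>\<phi>. cut_norm (\<lambda>x y. U x y - W (\<phi> x) (\<phi> y))) ` mp_bijections)"
  by (rule bdd_belowI2[of _ 0]) (rule cut_norm_overlay_nonneg[OF assms])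

lemma cut_dist_nonneg:
  assumes "graphon U" "graphon W"
  shows "0 \<le> cut_dist U W"
  unfolding cut_dist_def
proof (rule cINF_greatest)
  show "mp_bijections \<noteq> {}" using mp_bijections_id by blast
qed (rule cut_norm_overlay_nonneg[OF assms])

lemma cut_dist_refl:
  assumes "graphon W" shows "cut_dist W W = 0"
proof -
  have "cut_dist W W \<le> cut_norm (\<lambda>x y. W x y - W x y)"
    unfolding cut_dist_def by (rule cINF_lower[OF cut_dist_bdd_below[OF assms assms] mp_bijections_id])
  also have "\<dots> \<le> 0" by (rule cut_norm_least) (simp add: set_lebesgue_integral_def case_prod_beta)
  finally show ?thesis using cut_dist_nonneg[OF assms assms] by simp
qed

lemma cut_dist_sym_le:
  assumes "graphon U" "graphon W" shows "cut_dist W U \<le> cut_dist U W"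
  unfolding cut_dist_def[of U W]
proof (rule cINF_greatest)
  show "mp_bijections \<noteq> {}" using mp_bijections_id by blast
  fix \<phi> assume \<phi>: "\<phi> \<in> mp_bijections"
  let ?\<psi> = "the_inv_into \<I> \<phi>"
  have \<psi>: "?\<psi> \<in> mp_bijections" using mp_bijections_inverse[OF \<phi>] .
  have "\<phi> (?\<psi> x) = x" if "x \<in> \<I>" for x
    using \<phi> that by (intro f_the_inv_into_f) (auto simp: mp_bijections_def bij_betw_def)
  then have "cut_norm (\<lambda>x y. W x y - U (?\<psi> x) (?\<psi> y)) =
      cut_norm (\<lambda>x y. W (\<phi> (?\<psi> x)) (\<phi> (?\<psi> y)) - U (?\<psi> x) (?\<psi> y))"
    by (intro cut_norm_cong) auto
  also have "\<dots> \<le> cut_norm (\<lambda>x y. W (\<phi> x) (\<phi> y) - U x y)"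
    by (rule cut_norm_mp_bijection_le[OF bounded_kernel_diff[OF
          bounded_kernel_comp[OF bounded_kernel_graphon[OF assms(2)] \<phi>]
          bounded_kernel_graphon[OF assms(1)]] \<psi>])
  also have "\<dots> = cut_norm (\<lambda>x y. U x y - W (\<phi> x) (\<phi> y))" by (rule cut_norm_commute)
  finally show "cut_dist W U \<le> cut_norm (\<lambda>x y. U x y - W (\<phi> x) (\<phi> y))"
    using cINF_lower[OF cut_dist_bdd_below[OF assms(2,1)] \<psi>] by (simp add: cut_dist_def)
qed

lemma cut_dist_sym: "graphon U \<Longrightarrow> graphon W \<Longrightarrow> cut_dist U W = cut_dist W U"
  by (intro antisym cut_dist_sym_le)

lemma cut_dist_triangle:
  assumes "graphon U" "graphon V" "graphon W"
  shows "cut_dist U W \<le> cut_dist U V + cut_dist V W"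
proof -
  note bk = assms[THEN bounded_kernel_graphon]
  have ne: "mp_bijections \<noteq> {}" using mp_bijections_id by blast
  have *: "cut_dist U W \<le> cut_norm (\<lambda>x y. U x y - V (\<phi> x) (\<phi> y)) + cut_norm (\<lambda>x y. V x y - W (\<psi> x) (\<psi> y))"
    if \<phi>: "\<phi> \<in> mp_bijections" and \<psi>: "\<psi> \<in> mp_bijections" for \<phi> \<psi>
  proof -
    note \<psi>\<phi> = mp_bijections_compose[OF \<phi> \<psi>]
    have "cut_dist U W \<le> cut_norm (\<lambda>x y. U x y - W (\<psi> (\<phi> x)) (\<psi> (\<phi> y)))"
      unfolding cut_dist_def by (rule cINF_lower[OF cut_dist_bdd_below[OF assms(1,3)] \<psi>\<phi>])
    also have "\<dots> \<le> cut_norm (\<lambda>x y. U x y - V (\<phi> x) (\<phi> y)) +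
        cut_norm (\<lambda>x y. V (\<phi> x) (\<phi> y) - W (\<psi> (\<phi> x)) (\<psi> (\<phi> y)))"
      by (rule cut_norm_triangle[OF bk(1) bounded_kernel_comp[OF bk(2) \<phi>] bounded_kernel_comp[OF bk(3) \<psi>\<phi>]])
    also have "cut_norm (\<lambda>x y. V (\<phi> x) (\<phi> y) - W (\<psi> (\<phi> x)) (\<psi> (\<phi> y))) \<le> cut_norm (\<lambda>x y. V x y - W (\<psi> x) (\<psi> y))"
      by (rule cut_norm_mp_bijection_le[OF bounded_kernel_diff[OF bk(2) bounded_kernel_comp[OF bk(3) \<psi>]] \<phi>])
    finally show ?thesis by simp
  qed
  have "cut_dist U W - cut_norm (\<lambda>x y. U x y - V (\<phi> x) (\<phi> y)) \<le> cut_dist V W"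
    if "\<phi> \<in> mp_bijections" for \<phi>
    unfolding cut_dist_def[of V W]
    by (rule cINF_greatest[OF ne]) (use *[OF that] in \<open>simp add: algebra_simps\<close>)
  then have "cut_dist U W - cut_dist V W \<le> cut_dist U V"
    unfolding cut_dist_def[of U V]
    by (intro cINF_greatest[OF ne]) (simp add: algebra_simps)
  then show ?thesis by simp
qed

lemma equiv_graphon_rel: "equiv {W. graphon W} graphon_rel"
proof (rule equivI)
  show "graphon_rel \<subseteq> {W. graphon W} \<times> {W. graphon W}" by (auto simp: graphon_rel_def)
  show "refl_on {W. graphon W} graphon_rel"
    by (auto simp: refl_on_def graphon_rel_def cut_dist_refl)
  show "sym graphon_rel"
    by (auto simp: sym_def graphon_rel_def cut_dist_sym)
  show "trans graphon_rel"
  proof (rule transI)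
    fix U V W assume "(U, V) \<in> graphon_rel" "(V, W) \<in> graphon_rel"
    then show "(U, W) \<in> graphon_rel"
      using cut_dist_triangle[of U V W] cut_dist_nonneg[of U W] by (auto simp: graphon_rel_def)
  qed
qed

lemma class_dist_graphon_class:
  assumes "graphon U" "graphon W"
  shows "class_dist (graphon_class U) (graphon_class W) = cut_dist U W"
proof -
  have "cut_dist U' W' = cut_dist U W" if "U' \<in> graphon_class U" "W' \<in> graphon_class W" for U' W'
  proof -
    from that have g: "graphon U'" "graphon W'" "cut_dist U U' = 0" "cut_dist W W' = 0"
      by (auto simp: graphon_class_def graphon_rel_def)
    have "cut_dist U W \<le> cut_dist U U' + cut_dist U' W"
      "cut_dist U' W \<le> cut_dist U' W' + cut_dist W' W"
      "cut_dist U' W' \<le> cut_dist U' U + cut_dist U W'"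
      "cut_dist U W' \<le> cut_dist U W + cut_dist W W'"
      by (rule cut_dist_triangle; rule g assms)+
    moreover have "cut_dist U' U = 0" "cut_dist W' W = 0"
      using g(3,4) cut_dist_sym[OF assms(1) g(1)] cut_dist_sym[OF assms(2) g(2)] by simp_all
    ultimately show ?thesis using g(3,4) by linarith
  qed
  then have "(\<lambda>(U', W'). cut_dist U' W') ` (graphon_class U \<times> graphon_class W) =
      (\<lambda>_. cut_dist U W) ` (graphon_class U \<times> graphon_class W)"
    by (intro image_cong) auto
  moreover have "U \<in> graphon_class U" "W \<in> graphon_class W"
    using assms by (simp_all add: graphon_class_def graphon_rel_def cut_dist_refl)
  then have "graphon_class U \<times> graphon_class W \<noteq> {}" by blast
  ultimately show ?thesis by (simp add: class_dist_def)
qed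

lemma Union_graphon_space: "\<Union> graphon_space = {W. graphon W}"
  unfolding graphon_space_def by (rule Union_quotient[OF equiv_graphon_rel])

lemma graphon_W_bip: "graphon W_bip"
proof -
  let ?R = "{0..1/2} \<times> {1/2..1} \<union> {1/2..1} \<times> {0..1/2} :: (real \<times> real) set"
  have "?R \<in> sets lebesgue"
    by (intro sets.Un lebesgue_Times) auto
  then have "indicator ?R \<in> borel_measurable (lebesgue_on (\<I> \<times> \<I>))"
    by (intro measurable_restrict_space1 borel_measurable_indicator)
  moreover have "(\<lambda>(x, y). W_bip x y) = (indicator ?R :: _ \<Rightarrow> real)" by (auto simp: W_bip_def)
  moreover have "W_bip x y = W_bip y x" for x y
  proof -
    have "(x, y) \<in> ?R \<longleftrightarrow> (y, x) \<in> ?R" by (simp add: conj_commute disj_commute)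
    then show ?thesis by (simp only: W_bip_def indicator_def)
  qed
  moreover have "0 \<le> W_bip x y" "W_bip x y \<le> 1" for x y
    by (simp_all add: W_bip_def indicator_def)
  ultimately show ?thesis by (simp add: graphon_def)
qed

end

theory Submission
  imports Defs "HOL-Probability.Probability_Measure"
begin

text \<open>
  Write \<open>d\<close> for the degree function of \<open>W\<close>, \<open>p\<close> for its edge density and \<open>R\<close> for the density
  of three vertices spanning exactly the edge \<open>xy\<close>. Then
  \<open>t\<^sub>i\<^sub>n\<^sub>d(K\<^sub>1\<^sub>,\<^sub>2, W) + R = p - \<integral>d\<^sup>2 = 1/4 - \<integral>(d - 1/2)\<^sup>2\<close>, so the induced wedge density is at
  most \<open>1/4\<close>, with equality at the balanced bipartite graphon. As the edge and entropy terms are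
  bounded, this gives the limit of \<open>\<psi>/\<beta>\<^sub>2\<close> and shows that a maximizer satisfies
  \<open>t\<^sub>i\<^sub>n\<^sub>d \<ge> 1/4 - \<delta>\<^sup>2\<close> with \<open>\<delta>\<^sup>2 = O(1/\<beta>\<^sub>2)\<close>.

  For stability choose a vertex \<open>x\<^sub>0\<close> whose contributions to \<open>R\<close> and \<open>\<integral>(d - 1/2)\<^sup>2\<close> are both small,
  and put \<open>f = W(x\<^sub>0, \<cdot>)\<close>. Almost no non-edges run between \<open>f\<close> and \<open>1 - f\<close>, and then the edge
  density leaves no room for edges inside either part: \<open>W\<close> is \<open>L\<^sup>1\<close>-close to
  \<open>f(x)(1 - f(y)) + f(y)(1 - f(x))\<close>. Smallness of \<open>R\<close> for that kernel forces \<open>\<integral>f(1 - f)\<close> to be small,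
  so \<open>f\<close> is close to the indicator of a set of measure about \<open>1/2\<close>. That set is approximated by a
  union of intervals of equal length, and a permutation of these intervals moves it to an
  initial segment.
\<close>

section \<open>Kernels on a probability space\<close>

lemma (in prob_space) integrable_bounded:
  fixes f :: "'a \<Rightarrow> real"
  assumes "f \<in> borel_measurable M" "\<And>x. \<bar>f x\<bar> \<le> c"
  shows "integrable M f"
  using assms by (intro integrable_const_bound[of _ c]) auto

lemma mult_unit_interval:
  fixes a b :: real
  assumes "0 \<le> a \<and> a \<le> 1" "0 \<le> b \<and> b \<le> 1"
  shows "0 \<le> a * b \<and> a * b \<le> 1"
  using assms by (auto intro: mult_le_one)

text \<open>Fubini is applied twice. On products of probability spaces boundedness already gives
  integrability, so the bound \<open>c\<close> is the only analytic condition to check.\<close>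

lemma (in prob_space) integral_triple:
  fixes f :: "'a \<times> 'a \<times> 'a \<Rightarrow> real"
  assumes f[measurable]: "f \<in> borel_measurable (M \<Otimes>\<^sub>M (M \<Otimes>\<^sub>M M))" and b: "\<And>p. \<bar>f p\<bar> \<le> c"
  shows "(\<integral>p. f p \<partial>(M \<Otimes>\<^sub>M (M \<Otimes>\<^sub>M M))) = (\<integral>x. \<integral>y. \<integral>z. f (x, y, z) \<partial>M \<partial>M \<partial>M)"
proof -
  interpret P2: pair_prob_space M M ..
  interpret P3: pair_prob_space M "M \<Otimes>\<^sub>M M" ..
  have "(\<integral>p. f p \<partial>(M \<Otimes>\<^sub>M (M \<Otimes>\<^sub>M M))) = (\<integral>x. \<integral>q. f (x, q) \<partial>(M \<Otimes>\<^sub>M M) \<partial>M)"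
    using P3.integrable_bounded[OF f b] by (subst P3.integral_fst') auto
  also have "\<dots> = (\<integral>x. \<integral>y. \<integral>z. f (x, y, z) \<partial>M \<partial>M \<partial>M)"
  proof (intro Bochner_Integration.integral_cong refl)
    fix x assume [measurable]: "x \<in> space M"
    have "(\<lambda>q. f (x, q)) \<in> borel_measurable (M \<Otimes>\<^sub>M M)" by measurable
    then have "integrable (M \<Otimes>\<^sub>M M) (\<lambda>q. f (x, q))"
      using b by (rule P2.integrable_bounded)
    from P2.integral_fst'[OF this]
    show "(\<integral>q. f (x, q) \<partial>(M \<Otimes>\<^sub>M M)) = (\<integral>y. \<integral>z. f (x, y, z) \<partial>M \<partial>M)" by simp
  qed
  finally show ?thesis .
qed

text \<open>Symmetry and the range hold at every point, not just almost everywhere, so pointwise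
  identities can be integrated without exceptional sets. Every graphon agrees almost everywhere with
  such a kernel.\<close>

locale symmetric_kernel = prob_space M for M :: "'a measure" +
  fixes W :: "'a \<Rightarrow> 'a \<Rightarrow> real"
  assumes measurable_W: "case_prod W \<in> borel_measurable (M \<Otimes>\<^sub>M M)"
    and W_sym: "W x y = W y x"
    and W_unit: "0 \<le> W x y \<and> W x y \<le> 1"
begin

sublocale P2: pair_prob_space M M ..
sublocale P3: pair_prob_space M "M \<Otimes>\<^sub>M M" ..

lemma W_measurable [measurable]:
  "f \<in> N \<rightarrow>\<^sub>M M \<Longrightarrow> g \<in> N \<rightarrow>\<^sub>M M \<Longrightarrow> (\<lambda>x. W (f x) (g x)) \<in> borel_measurable N"
  using measurable_compose[OF measurable_Pair measurable_W] by simp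

section \<open>Induced densities and degrees\<close>

definition wedge :: "real" where
  "wedge = (\<integral>(x, y, z). W x y * W x z * (1 - W y z) \<partial>(M \<Otimes>\<^sub>M (M \<Otimes>\<^sub>M M)))"

definition lone_edge :: "real" where
  "lone_edge = (\<integral>(x, y, z). W x y * (1 - W x z) * (1 - W y z) \<partial>(M \<Otimes>\<^sub>M (M \<Otimes>\<^sub>M M)))"

definition degree :: "'a \<Rightarrow> real" where
  "degree x = (\<integral>y. W x y \<partial>M)"

lemma degree_measurable [measurable]: "degree \<in> borel_measurable M"
  unfolding degree_def by measurable

lemma degree_unit: "0 \<le> degree x \<and> degree x \<le> 1"
proof (cases "integrable M (W x)")
  case True
  then have "degree x \<le> (\<integral>y. 1 \<partial>M)"
    unfolding degree_def using W_unit by (intro integral_mono) auto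
  moreover have "0 \<le> degree x" unfolding degree_def using W_unit by (intro Bochner_Integration.integral_nonneg) auto
  ultimately show ?thesis by (simp add: prob_space)
\<comment> \<open>For \<open>x\<close> outside \<open>space M\<close> the section \<open>W x\<close>
  may fail to be measurable; its integral is then 0 by default.\<close>
qed (simp add: degree_def not_integrable_integral_eq)

abbreviation edges :: real where "edges \<equiv> expectation degree"

lemma integrable_degree: "integrable M degree" "integrable M (\<lambda>x. (degree x)\<^sup>2)"
proof -
  have "\<bar>degree x\<bar> \<le> 1" for x using degree_unit[of x] by auto
  then show "integrable M degree" "integrable M (\<lambda>x. (degree x)\<^sup>2)"
    by (auto intro!: integrable_bounded[of _ 1] simp: power_le_one_iff abs_square_le_1)
qed

lemma unit_bounds:
  "0 \<le> W x y" "W x y \<le> 1" "0 \<le> 1 - W x y" "1 - W x y \<le> 1"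
  using W_unit by auto

lemma integrable_W2: "integrable (M \<Otimes>\<^sub>M M) (\<lambda>(x, y). W x y)"
  using W_unit by (intro P2.integrable_bounded[of _ 1]) (auto simp: unit_bounds)

lemma integral_W2: "(\<integral>(x, y). W x y \<partial>(M \<Otimes>\<^sub>M M)) = edges"
  using P2.integral_fst'[OF integrable_W2] by (simp add: degree_def[abs_def])

text \<open>Inclusion-exclusion expresses both densities through the edge density, the cherry density
  and the triangle density; the triangles cancel in the sum.\<close>

lemma wedge_plus_lone_edge: "wedge + lone_edge = edges - (\<integral>x. (degree x)\<^sup>2 \<partial>M)"
proof -
  let ?N = "M \<Otimes>\<^sub>M (M \<Otimes>\<^sub>M M)"
  have i: "integrable ?N (\<lambda>(x, y, z). W x y * W x z * (1 - W y z))"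
    "integrable ?N (\<lambda>(x, y, z). W x y * (1 - W x z) * (1 - W y z))"
    "integrable ?N (\<lambda>(x, y, z). W x y)"
    "integrable ?N (\<lambda>(x, y, z). W x y * W y z)"
    by (auto intro!: P3.integrable_bounded[of _ 1] mult_le_one simp: abs_mult unit_bounds)
  have "wedge + lone_edge =
    (\<integral>p. (\<lambda>(x, y, z). W x y * W x z * (1 - W y z)) p + (\<lambda>(x, y, z). W x y * (1 - W x z) * (1 - W y z)) p \<partial>?N)"
    unfolding wedge_def lone_edge_def
    by (rule Bochner_Integration.integral_add[symmetric]) (rule i)+
  \<comment> \<open>The factors \<open>W x z\<close> and \<open>1 - W x z\<close> add up to 1, so
    the sum of the integrands is \<open>W x y * (1 - W y z)\<close>.\<close>
  also have "\<dots> = (\<integral>p. (\<lambda>(x, y, z). W x y) p - (\<lambda>(x, y, z). W x y * W y z) p \<partial>?N)"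
    by (intro Bochner_Integration.integral_cong) (auto simp: algebra_simps)
  also have "\<dots> = (\<integral>(x, y, z). W x y \<partial>?N) - (\<integral>(x, y, z). W x y * W y z \<partial>?N)"
    by (rule Bochner_Integration.integral_diff) (rule i)+
  also have "(\<integral>(x, y, z). W x y \<partial>?N) = edges"
    using integral_triple[of "\<lambda>(x, y, z). W x y" 1]
    by (simp add: degree_def[abs_def] prob_space unit_bounds split_beta')
  also have "(\<integral>(x, y, z). W x y * W y z \<partial>?N) = (\<integral>x. \<integral>y. W x y * degree y \<partial>M \<partial>M)"
    by (subst integral_triple[of _ 1])
       (auto simp: degree_def unit_bounds abs_mult intro!: mult_le_one)
  \<comment> \<open>With \<open>x\<close> innermost, symmetry turns the remaining integral of
    \<open>W x y\<close> into a second factor \<open>degree y\<close>.\<close>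
  also have "\<dots> = (\<integral>y. \<integral>x. W x y * degree y \<partial>M \<partial>M)"
  proof (rule P2.Fubini_integral[symmetric])
    show "integrable (M \<Otimes>\<^sub>M M) (\<lambda>(x, y). W x y * degree y)"
      using degree_unit
      by (auto intro!: P2.integrable_bounded[of _ 1] mult_le_one simp: abs_mult unit_bounds)
  qed
  also have "\<dots> = (\<integral>y. (degree y)\<^sup>2 \<partial>M)"
    by (simp add: W_sym[of _ y for y] power2_eq_square) (simp add: degree_def)
  finally show ?thesis .
qed

lemma lone_edge_nonneg: "0 \<le> lone_edge"
  unfolding lone_edge_def by (intro Bochner_Integration.integral_nonneg) (auto simp: unit_bounds)

lemma edges_sq: "edges\<^sup>2 \<le> (\<integral>x. (degree x)\<^sup>2 \<partial>M)"
  using variance_eq[OF integrable_degree] variance_positive[of degree] by linarith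

text \<open>Drop \<open>lone_edge\<close>, bound the second moment of the degree below by
  \<open>edges\<^sup>2\<close>, and complete the square.\<close>

lemma wedge_le: "wedge \<le> 1/4 - (edges - 1/2)\<^sup>2"
  using wedge_plus_lone_edge lone_edge_nonneg edges_sq by (auto simp: power2_eq_square algebra_simps)

end

section \<open>Fractional complete bipartite kernels\<close>

text \<open>For the indicator of a set this is the complete bipartite kernel between the set and its
  complement. In general it is the probability that exactly one of two independent coins with biases
  \<open>f x\<close> and \<open>f y\<close> shows heads.\<close>

definition bip_kernel :: "('a \<Rightarrow> real) \<Rightarrow> 'a \<Rightarrow> 'a \<Rightarrow> real" where
  "bip_kernel f x y = f x * (1 - f y) + f y * (1 - f x)"

lemma bip_kernel_unit:
  assumes "\<And>x. 0 \<le> f x \<and> f x \<le> 1"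
  shows "0 \<le> bip_kernel f x y" "bip_kernel f x y \<le> 1"
proof -
  show "0 \<le> bip_kernel f x y"
    using assms[of x] assms[of y] by (simp add: bip_kernel_def)
  have "f x * (1 - f y) + f y * (1 - f x) \<le> f x * 1 + 1 * (1 - f x)"
    using assms[of x] assms[of y] by (intro add_mono mult_mono) auto
  then show "bip_kernel f x y \<le> 1" by (simp add: bip_kernel_def)
qed

text \<open>The kernel is affine in each of \<open>f x\<close> and \<open>f y\<close>, with slope
  \<open>1 - 2 * t\<close> where \<open>t\<close> is the other value, hence of absolute value at
  most 1. The two values are changed one after the other.\<close>

lemma bip_kernel_diff_le:
  assumes "\<And>x. 0 \<le> f x \<and> f x \<le> 1" "\<And>x. 0 \<le> h x \<and> h x \<le> 1"
  shows "\<bar>bip_kernel f x y - bip_kernel h x y\<bar> \<le> \<bar>f x - h x\<bar> + \<bar>f y - h y\<bar>"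
proof -
  have "bip_kernel f x y - bip_kernel h x y = (f x - h x) * (1 - 2 * f y) + (f y - h y) * (1 - 2 * h x)"
    by (simp add: bip_kernel_def algebra_simps)
  also have "\<bar>\<dots>\<bar> \<le> \<bar>f x - h x\<bar> * \<bar>1 - 2 * f y\<bar> + \<bar>f y - h y\<bar> * \<bar>1 - 2 * h x\<bar>"
    by (metis abs_mult abs_triangle_ineq)
  also have "\<dots> \<le> \<bar>f x - h x\<bar> * 1 + \<bar>f y - h y\<bar> * 1"
    using assms(1)[of y] assms(2)[of x] by (intro add_mono mult_left_mono) auto
  finally show ?thesis by simp
qed

text \<open>The left side is one of the nonnegative terms in the expansion of the right side. Its
  variables separate, and its integral is the product of
  \<open>(\<integral>f\<^sup>2)\<^sup>2\<close> and \<open>\<integral>f(1 - f)\<close>, which is how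
  a small lone-edge density forces \<open>f\<close> to be nearly 0-1 valued.\<close>

lemma bip_kernel_lone_edge_ge:
  assumes "\<And>x. 0 \<le> f x \<and> f x \<le> 1"
  shows "(f x)\<^sup>2 * (f y * (1 - f y)) * (f z)\<^sup>2
    \<le> bip_kernel f x y * (1 - bip_kernel f x z) * (1 - bip_kernel f y z)"
proof -
  have e: "1 - bip_kernel f u v = f u * f v + (1 - f u) * (1 - f v)" for u v
    by (simp add: bip_kernel_def algebra_simps)
  have "(f x)\<^sup>2 * (f y * (1 - f y)) * (f z)\<^sup>2 = (f x * (1 - f y)) * (f x * f z) * (f y * f z)"
    by (simp add: power2_eq_square)
  also have "\<dots> \<le> bip_kernel f x y * (1 - bip_kernel f x z) * (1 - bip_kernel f y z)"
    unfolding e unfolding bip_kernel_def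
    using assms[of x] assms[of y] assms[of z] by (intro mult_mono add_increasing2) auto
  finally show ?thesis .
qed

text \<open>Telescoping: one factor is replaced at a time while the other two stay in the unit
  interval.\<close>

lemma triple_product_diff_le:
  fixes a b c a' b' c' :: real
  assumes "0 \<le> a" "a \<le> 1" "0 \<le> b" "b \<le> 1" "0 \<le> c" "c \<le> 1" "0 \<le> a'" "a' \<le> 1" "0 \<le> b'" "b' \<le> 1" "0 \<le> c'" "c' \<le> 1"
  shows "a' * b' * c' \<le> a * b * c + \<bar>a - a'\<bar> + \<bar>b - b'\<bar> + \<bar>c - c'\<bar>"
proof -
  have "a' * b' * c' - a * b * c = (a' - a) * (b' * c') + (b' - b) * (a * c') + (c' - c) * (a * b)"
    by (simp add: algebra_simps)
  also have "\<dots> \<le> \<bar>a - a'\<bar> * 1 + \<bar>b - b'\<bar> * 1 + \<bar>c - c'\<bar> * 1"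
    using assms by (intro add_mono mult_mono mult_le_one) auto
  finally show ?thesis by simp
qed

section \<open>Stability of the wedge bound\<close>

context symmetric_kernel
begin

text \<open>Here \<open>x\<close> is an endpoint of the lone edge. With \<open>f = W x\<close> the
  integral measures the non-edges between \<open>f\<close> and \<open>1 - f\<close>.\<close>

definition lone_edge_at :: "'a \<Rightarrow> real" where
  "lone_edge_at x = (\<integral>(y, z). W x y * (1 - W x z) * (1 - W y z) \<partial>(M \<Otimes>\<^sub>M M))"

lemma integrable_lone_edge:
  "integrable (M \<Otimes>\<^sub>M (M \<Otimes>\<^sub>M M)) (\<lambda>(x, y, z). W x y * (1 - W x z) * (1 - W y z))"
  by (auto intro!: P3.integrable_bounded[of _ 1] mult_le_one simp: abs_mult unit_bounds)

lemma integral_lone_edge_at: "integrable M lone_edge_at" "expectation lone_edge_at = lone_edge"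
  using P3.integrable_fst'[OF integrable_lone_edge] P3.integral_fst'[OF integrable_lone_edge]
  by (simp_all add: lone_edge_at_def[abs_def] lone_edge_def)

lemma lone_edge_at_nonneg: "0 \<le> lone_edge_at x"
  unfolding lone_edge_at_def by (intro Bochner_Integration.integral_nonneg) (auto simp: unit_bounds)

text \<open>The mean of the bounded quantity is exactly \<open>1/4 - wedge\<close>, so some vertex
  does not exceed it. Adding the two nonnegative terms first makes both small at the same
  vertex.\<close>

lemma obtain_typical_vertex:
  assumes "1/4 - \<epsilon> \<le> wedge"
  obtains x where "x \<in> space M" "(degree x - 1/2)\<^sup>2 + lone_edge_at x \<le> \<epsilon>"
proof -
  let ?h = "\<lambda>x. (degree x - 1/2)\<^sup>2 + lone_edge_at x"
  have e: "?h = (\<lambda>x. (degree x)\<^sup>2 - degree x + 1/4 + lone_edge_at x)"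
    by (auto simp: power2_eq_square algebra_simps)
  have i: "integrable M ?h"
    unfolding e using integrable_degree integral_lone_edge_at by auto
  have "expectation ?h = (\<integral>x. (degree x)\<^sup>2 \<partial>M) - edges + 1/4 + lone_edge"
    unfolding e using integrable_degree integral_lone_edge_at by (simp add: prob_space)
  also have "\<dots> \<le> \<epsilon>"
    using assms wedge_plus_lone_edge by simp
  finally have le: "expectation ?h \<le> \<epsilon>" .
  have "\<exists>x\<in>space M. ?h x \<le> \<epsilon>"
  proof (rule ccontr)
    assume "\<not> ?thesis"
    then have "expectation ?h > \<epsilon>"
      using i by (intro expectation_greater) (auto simp: not_le)
    with le show False by simp
  qed
  with that show thesis by blast
qed

text \<open>The function \<open>f\<close> is the neighbourhood of a typical vertex. The condition
  \<open>\<delta> \<le> 1/4\<close> lets \<open>\<delta>\<^sup>2\<close> be absorbed into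
  \<open>\<delta> / 4\<close> and keeps the mean of \<open>f\<close> at least 1/4, so that its
  second moment stays away from 0.\<close>

lemma near_bipartite:
  assumes "1/4 - \<delta>\<^sup>2 \<le> wedge" "0 \<le> \<delta>" "\<delta> \<le> 1/4"
  obtains f where "f \<in> borel_measurable M" "\<And>x. 0 \<le> f x \<and> f x \<le> 1" "\<bar>expectation f - 1/2\<bar> \<le> \<delta>"
    "(\<integral>(x, y). \<bar>W x y - bip_kernel f x y\<bar> \<partial>(M \<Otimes>\<^sub>M M)) \<le> 7 * \<delta>"
    "(\<integral>x. f x * (1 - f x) \<partial>M) \<le> 5632 * \<delta>"
proof -
  obtain x0 where x0: "x0 \<in> space M" "(degree x0 - 1/2)\<^sup>2 + lone_edge_at x0 \<le> \<delta>\<^sup>2"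
    using obtain_typical_vertex[OF assms(1)] .
  define f where "f = W x0"
  define m where "m = expectation f"
  note [measurable] = x0(1)
  have fm[measurable]: "f \<in> borel_measurable M" unfolding f_def by measurable
  have f: "0 \<le> f x \<and> f x \<le> 1" for x unfolding f_def using W_unit by auto
  then have f': "0 \<le> f x" "f x \<le> 1" for x by auto
  have Bm[measurable]: "(\<lambda>p. bip_kernel f (u p) (v p)) \<in> borel_measurable N"
    if [measurable]: "u \<in> N \<rightarrow>\<^sub>M M" "v \<in> N \<rightarrow>\<^sub>M M" for u v N
    unfolding bip_kernel_def by measurable
  have B: "0 \<le> bip_kernel f x y" "bip_kernel f x y \<le> 1" for x y
    using bip_kernel_unit[of f x y] f by auto
  let ?D = "\<lambda>x y. \<bar>W x y - bip_kernel f x y\<bar>"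
  have D: "?D x y \<le> 1" for x y
    using unit_bounds[of x y] B[of x y] by linarith
  have mi: "m = degree x0" by (simp add: m_def f_def degree_def)
  have \<delta>2: "\<delta>\<^sup>2 \<le> \<delta> / 4" using mult_left_mono[OF assms(3,2)] by (simp add: power2_eq_square)
  have lone: "lone_edge_at x0 \<le> \<delta>\<^sup>2" using x0(2) zero_le_power2[of "degree x0 - 1/2"] by linarith
  have m2: "(m - 1/2)\<^sup>2 \<le> \<delta>\<^sup>2" using x0(2) lone_edge_at_nonneg[of x0] by (simp add: mi)
  then have m: "\<bar>m - 1/2\<bar> \<le> \<delta>" using power2_le_iff_abs_le[OF assms(2)] by blast
  \<comment> \<open>The upper bound on \<open>wedge\<close> loses
    \<open>(edges - 1/2)\<^sup>2\<close>, so a nearly maximal \<open>wedge\<close> pins down the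
    edge density as well.\<close>
  have "(edges - 1/2)\<^sup>2 \<le> \<delta>\<^sup>2" using wedge_le assms(1) by linarith
  then have ed: "edges \<le> 1/2 + \<delta>" using power2_le_iff_abs_le[OF assms(2), of "edges - 1/2"] by (simp add: abs_le_iff)

  let ?N = "M \<Otimes>\<^sub>M M"
  let ?F = "\<lambda>(y, z). f y * (1 - f z)" and ?G = "\<lambda>(y, z). f y * (1 - f z) * (1 - W y z)"
  have i: "integrable ?N ?F" "integrable ?N ?G"
    using f' by (auto intro!: P2.integrable_bounded[of _ 1] mult_le_one simp: abs_mult unit_bounds)
  have "integrable M f" using f' by (intro integrable_bounded[of _ 1]) auto
  then have I1: "(\<integral>p. ?F p \<partial>?N) = m * (1 - m)"
    using P2.integral_fst'[OF i(1)] by (simp add: m_def prob_space)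
  have I2: "(\<integral>p. ?G p \<partial>?N) \<le> \<delta>\<^sup>2"
    using lone by (simp add: lone_edge_at_def f_def)
  \<comment> \<open>The estimate below uses \<open>?F\<close> and \<open>?G\<close> in both
    orientations; transposing the coordinates preserves integrals and integrability.\<close>
  have s: "(\<integral>(y, z). H z y \<partial>?N) = (\<integral>p. case_prod H p \<partial>?N)" "integrable ?N (\<lambda>(y, z). H z y)"
    if "integrable ?N (case_prod H)" for H :: "'a \<Rightarrow> 'a \<Rightarrow> real"
    using P2.integral_product_swap[of "case_prod H"] that P2.integrable_product_swap[of "case_prod H"]
    by (auto simp: split_beta')
  note s' = s[of "\<lambda>y z. f y * (1 - f z)"] s[of "\<lambda>y z. f y * (1 - f z) * (1 - W y z)"]
  note ii = i s'(2)[OF i(1)] s'(4)[OF i(2)] integrable_W2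
  have lin: "(\<integral>p. a p - b p - c p + 2 * d p + 2 * e p \<partial>?N) =
      (\<integral>p. a p \<partial>?N) - (\<integral>p. b p \<partial>?N) - (\<integral>p. c p \<partial>?N) + 2 * (\<integral>p. d p \<partial>?N) + 2 * (\<integral>p. e p \<partial>?N)"
    if "integrable ?N a" "integrable ?N b" "integrable ?N c" "integrable ?N d" "integrable ?N e"
    for a b c d e :: "'a \<times> 'a \<Rightarrow> real"
    using that by simp
  have "(\<integral>(y, z). \<bar>W y z - bip_kernel f y z\<bar> \<partial>?N)
      \<le> (\<integral>p. (\<lambda>(y, z). W y z) p - ?F p - (\<lambda>(y, z). f z * (1 - f y)) p
        + 2 * ?G p + 2 * (\<lambda>(y, z). f z * (1 - f y) * (1 - W z y)) p \<partial>?N)"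
  proof (rule integral_mono)
    show "integrable ?N (\<lambda>(y, z). \<bar>W y z - bip_kernel f y z\<bar>)"
      using D by (auto intro!: P2.integrable_bounded[of _ 1])
    fix p :: "'a \<times> 'a"
    obtain y z where p: "p = (y, z)" by force
    \<comment> \<open>The positive terms are edges inside the two parts, the negative ones non-edges
      across. The inside edges are then rewritten as all edges minus those across, leaving only the
      edge density, the mean of \<open>f\<close> and the non-edges across.\<close>
    have "W y z - bip_kernel f y z =
        f y * W y z * f z + (1 - f y) * W y z * (1 - f z) - f y * (1 - f z) * (1 - W y z) - f z * (1 - f y) * (1 - W y z)"
      by (simp add: bip_kernel_def algebra_simps)
    moreover have "0 \<le> f y * W y z * f z" "0 \<le> (1 - f y) * W y z * (1 - f z)"
      "0 \<le> f y * (1 - f z) * (1 - W y z)" "0 \<le> f z * (1 - f y) * (1 - W y z)"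
      using f' by (auto simp: unit_bounds)
    ultimately have "\<bar>W y z - bip_kernel f y z\<bar> \<le>
        f y * W y z * f z + (1 - f y) * W y z * (1 - f z) + f y * (1 - f z) * (1 - W y z) + f z * (1 - f y) * (1 - W y z)"
      by linarith
    also have "\<dots> = W y z - f y * (1 - f z) - f z * (1 - f y)
        + 2 * (f y * (1 - f z) * (1 - W y z)) + 2 * (f z * (1 - f y) * (1 - W y z))"
      by (simp add: algebra_simps)
    finally show "(\<lambda>(y, z). \<bar>W y z - bip_kernel f y z\<bar>) p
      \<le> (\<lambda>(y, z). W y z) p - ?F p - (\<lambda>(y, z). f z * (1 - f y)) p
        + 2 * ?G p + 2 * (\<lambda>(y, z). f z * (1 - f y) * (1 - W z y)) p"
      by (simp add: p W_sym[of z y])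
  qed (intro Bochner_Integration.integrable_add Bochner_Integration.integrable_diff integrable_mult_right ii)
  also have "\<dots> = edges - m * (1 - m) - m * (1 - m) + 2 * (\<integral>p. ?G p \<partial>?N) + 2 * (\<integral>p. ?G p \<partial>?N)"
    using s'(1)[OF i(1)] s'(3)[OF i(2)] by (simp only: lin[OF ii(5,1,3,2,4)] I1 integral_W2)
  also have "\<dots> \<le> edges - 2 * (m * (1 - m)) + 4 * \<delta>\<^sup>2"
    using I2 by simp
  also have "m * (1 - m) = 1/4 - (m - 1/2)\<^sup>2"
    by (simp add: power2_eq_square algebra_simps)
  \<comment> \<open>By the bounds on \<open>edges\<close> and \<open>m\<close> the left side is at
    most \<open>\<delta> + 6 * \<delta>\<^sup>2\<close>.\<close>
  also have "edges - 2 * (1/4 - (m - 1/2)\<^sup>2) + 4 * \<delta>\<^sup>2 \<le> 7 * \<delta>"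
    using ed m2 \<delta>2 assms(2) by argo
  finally have L1: "(\<integral>(y, z). \<bar>W y z - bip_kernel f y z\<bar> \<partial>?N) \<le> 7 * \<delta>" .

  let ?T = "M \<Otimes>\<^sub>M (M \<Otimes>\<^sub>M M)"
  have Di: "integrable ?T (\<lambda>(x, y, z). ?D x y)" "integrable ?T (\<lambda>(x, y, z). ?D x z)" "integrable ?T (\<lambda>(x, y, z). ?D y z)"
    using D by (auto intro!: P3.integrable_bounded[of _ 1])
  have D2: "integrable ?N (\<lambda>(x, y). ?D x y)"
    using D by (auto intro!: P2.integrable_bounded[of _ 1])
  have Dv: "(\<integral>(x, y, z). ?D x y \<partial>?T) \<le> 7 * \<delta>" "(\<integral>(x, y, z). ?D x z \<partial>?T) \<le> 7 * \<delta>" "(\<integral>(x, y, z). ?D y z \<partial>?T) \<le> 7 * \<delta>"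
    using L1 P2.integral_fst'[OF D2] D
    by (subst integral_triple[of _ 1]; auto simp: prob_space)+
  let ?Q = "\<lambda>(x, y, z). (f x)\<^sup>2 * (f y * (1 - f y)) * (f z)\<^sup>2"
  have q: "integrable ?T ?Q"
    using f' by (auto intro!: P3.integrable_bounded[of _ 1] mult_le_one simp: abs_mult power_le_one_iff)
  \<comment> \<open>The lone-edge integrand of \<open>bip_kernel f\<close> dominates
    \<open>?Q\<close>. Passing from that kernel to \<open>W\<close> costs one \<open>?D\<close> per
    factor, each with integral at most \<open>7 * \<delta>\<close>.\<close>
  have "(\<integral>p. ?Q p \<partial>?T) \<le> (\<integral>p. (\<lambda>(x, y, z). W x y * (1 - W x z) * (1 - W y z)) p
      + (\<lambda>(x, y, z). ?D x y) p + (\<lambda>(x, y, z). ?D x z) p + (\<lambda>(x, y, z). ?D y z) p \<partial>?T)"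
  proof (rule integral_mono[OF q])
    fix p :: "'a \<times> 'a \<times> 'a"
    obtain x y z where p: "p = (x, y, z)" by (metis prod.collapse)
    show "?Q p \<le> (\<lambda>(x, y, z). W x y * (1 - W x z) * (1 - W y z)) p
      + (\<lambda>(x, y, z). ?D x y) p + (\<lambda>(x, y, z). ?D x z) p + (\<lambda>(x, y, z). ?D y z) p"
      unfolding p using bip_kernel_lone_edge_ge[of f x y z] f
        triple_product_diff_le[of "W x y" "1 - W x z" "1 - W y z" "bip_kernel f x y" "1 - bip_kernel f x z" "1 - bip_kernel f y z"]
        unit_bounds B by (auto simp: abs_minus_commute)
  qed (intro Bochner_Integration.integrable_add integrable_lone_edge Di)
  also have "\<dots> = lone_edge + (\<integral>(x, y, z). ?D x y \<partial>?T) + (\<integral>(x, y, z). ?D x z \<partial>?T) + (\<integral>(x, y, z). ?D y z \<partial>?T)"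
    unfolding lone_edge_def
    by (simp only: Bochner_Integration.integral_add Bochner_Integration.integrable_add integrable_lone_edge Di)
  also have "\<dots> \<le> \<delta>\<^sup>2 + 21 * \<delta>"
  proof -
    have "edges - edges\<^sup>2 = 1/4 - (edges - 1/2)\<^sup>2" by (simp add: power2_eq_square algebra_simps)
    then have "lone_edge \<le> \<delta>\<^sup>2"
      using wedge_plus_lone_edge edges_sq assms(1) zero_le_power2[of "edges - 1/2"] by linarith
    with Dv show ?thesis by linarith
  qed
  also have "\<dots> \<le> 22 * \<delta>" using \<delta>2 assms(2) by simp
  also have "(\<integral>p. ?Q p \<partial>?T) = (\<integral>x. (f x)\<^sup>2 \<partial>M)\<^sup>2 * (\<integral>x. f x * (1 - f x) \<partial>M)"
  proof -
    have "\<bar>?Q p\<bar> \<le> 1" for p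
      using f' by (auto intro!: mult_le_one simp: abs_mult power_le_one_iff split: prod.split)
    then show ?thesis
      by (subst integral_triple) (auto simp: power2_eq_square[of "\<integral>x. (f x)\<^sup>2 \<partial>M"])
  qed
  finally have Q: "(\<integral>x. (f x)\<^sup>2 \<partial>M)\<^sup>2 * (\<integral>x. f x * (1 - f x) \<partial>M) \<le> 22 * \<delta>" .
  have fi: "integrable M f" "integrable M (\<lambda>x. (f x)\<^sup>2)"
    using f' by (auto intro!: integrable_bounded[of _ 1] simp: power_le_one_iff)
  have "(1/4)\<^sup>2 \<le> m\<^sup>2" using m assms(3) by (intro power_mono) auto
  also have "m\<^sup>2 \<le> (\<integral>x. (f x)\<^sup>2 \<partial>M)"
    using variance_eq[OF fi] variance_positive[of f] by (simp add: m_def)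
  finally have "1/16 \<le> (\<integral>x. (f x)\<^sup>2 \<partial>M)" by (simp add: power2_eq_square)
  then have lo: "(1/16)\<^sup>2 \<le> (\<integral>x. (f x)\<^sup>2 \<partial>M)\<^sup>2" by (intro power_mono) auto
  have "0 \<le> (\<integral>x. f x * (1 - f x) \<partial>M)" using f' by (intro Bochner_Integration.integral_nonneg) auto
  \<comment> \<open>Dividing by \<open>(1/16)\<^sup>2\<close> gives the constant
    \<open>5632 = 22 * 256\<close>.\<close>
  from order_trans[OF mult_right_mono[OF lo this] Q]
  have "(\<integral>x. f x * (1 - f x) \<partial>M) \<le> 5632 * \<delta>" by (simp add: power2_eq_square)
  with fm f m L1 show thesis by (intro that[of f]) (auto simp: m_def)
qed

end

section \<open>Graphons and their Borel versions\<close>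

text \<open>Completion does not change the integral of a Borel function, and \<open>G\<close> need
  only agree almost everywhere on \<open>X\<close> with the Borel function \<open>F\<close>. This is
  the passage from Lebesgue integrals to products of probability measures.\<close>

lemma integral_lebesgue_density:
  fixes F G :: "'a :: euclidean_space \<Rightarrow> real"
  assumes [measurable]: "F \<in> borel_measurable borel" "X \<in> sets borel"
    and ae: "AE p in density lborel (indicator X). G p = F p"
  shows "(LINT p:X|lebesgue. G p) = (\<integral>p. F p \<partial>density lborel (indicator X))"
proof -
  have "AE p in lborel. p \<in> X \<longrightarrow> G p = F p"
    using ae by (subst (asm) AE_density) (auto simp: indicator_def split: if_splits)
  then have "AE p in lborel. indicator X p * F p = indicator X p * G p"
    by (rule AE_mp) (auto simp: indicator_def)
  then have ae': "AE p in lebesgue. indicator X p * F p = indicator X p * G p"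
    by (rule AE_completion)
  have m: "(\<lambda>p. indicator X p * F p) \<in> borel_measurable lebesgue"
    by (intro measurable_completion) measurable
  have "(LINT p:X|lebesgue. G p) = (\<integral>p. indicator X p * G p \<partial>lebesgue)"
    by (simp add: set_lebesgue_integral_def)
  also have "\<dots> = (\<integral>p. indicator X p * F p \<partial>lebesgue)"
    using ae' by (intro integral_cong_AE borel_measurable_AE[OF m ae'] m) auto
  also have "\<dots> = (\<integral>p. indicator X p * F p \<partial>lborel)"
    by (rule integral_completion) measurable
  also have "\<dots> = (\<integral>p. F p \<partial>density lborel (\<lambda>p. ennreal (indicator X p)))"
    by (subst integral_density) auto
  finally show ?thesis by (simp add: ennreal_indicator)
qed

section \<open>The uniform measure and its powers\<close>

text \<open>As a density on the whole line, the uniform distribution has \<open>UNIV\<close> as its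
  space, which removes membership side conditions, and its powers are again densities of
  \<open>lborel\<close>.\<close>

definition unit_measure :: "real measure" where
  "unit_measure = density lborel (indicator \<I>)"

lemma sets_unit_measure [measurable_cong]: "sets unit_measure = sets borel"
  by (simp add: unit_measure_def)

lemma space_unit_measure [simp]: "space unit_measure = UNIV"
  by (simp add: unit_measure_def)

lemma prob_space_unit_measure: "prob_space unit_measure"
  by (rule prob_spaceI) (simp add: unit_measure_def emeasure_density)

interpretation U: prob_space unit_measure by (rule prob_space_unit_measure)
interpretation U2: pair_prob_space unit_measure unit_measure ..
interpretation U3: pair_prob_space unit_measure "unit_measure \<Otimes>\<^sub>M unit_measure" ..

lemma density_lborel_Times:
  fixes X :: "'a::euclidean_space set" and Y :: "'b::euclidean_space set"
  assumes [measurable]: "X \<in> sets borel" "Y \<in> sets borel"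
    and "sigma_finite_measure (density lborel (indicator Y))"
  shows "density lborel (indicator X) \<Otimes>\<^sub>M density lborel (indicator Y) = density lborel (indicator (X \<times> Y))"
proof -
  have "density lborel (indicator X) \<Otimes>\<^sub>M density lborel (indicator Y) =
      density (lborel \<Otimes>\<^sub>M lborel) (\<lambda>(x, y). indicator X x * indicator Y y)"
    using assms(3) by (intro pair_measure_density) (auto simp: lborel.sigma_finite_measure_axioms)
  also have "(\<lambda>(x, y). indicator X x * indicator Y y) = (indicator (X \<times> Y) :: _ \<Rightarrow> ennreal)"
    by (auto simp: indicator_def)
  finally show ?thesis by (simp add: lborel_prod)
qed

lemma unit_measure_square: "unit_measure \<Otimes>\<^sub>M unit_measure = density lborel (indicator (\<I> \<times> \<I>))"
  unfolding unit_measure_def using U.sigma_finite_measure_axioms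
  by (intro density_lborel_Times) (auto simp: unit_measure_def)

lemma unit_measure_cube:
  "unit_measure \<Otimes>\<^sub>M (unit_measure \<Otimes>\<^sub>M unit_measure) = density lborel (indicator (\<I> \<times> \<I> \<times> \<I>))"
proof -
  have "sigma_finite_measure (density lborel (indicator (\<I> \<times> \<I>)))"
    using U2.sigma_finite_measure_axioms by (simp add: unit_measure_square)
  then show ?thesis
    unfolding unit_measure_square unfolding unit_measure_def
    by (intro density_lborel_Times) (auto intro!: borel_Times)
qed

lemma unit_square_borel [measurable]: "\<I> \<times> \<I> \<in> sets borel" "\<I> \<times> \<I> \<times> \<I> \<in> sets borel"
  by (auto intro!: borel_Times)

lemma integral_unit_square:
  fixes F G :: "real \<times> real \<Rightarrow> real"
  assumes F: "F \<in> borel_measurable (unit_measure \<Otimes>\<^sub>M unit_measure)"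
    and "AE p in unit_measure \<Otimes>\<^sub>M unit_measure. G p = F p"
  shows "(LINT p:\<I> \<times> \<I>|lebesgue. G p) = (\<integral>p. F p \<partial>(unit_measure \<Otimes>\<^sub>M unit_measure))"
  using assms unfolding unit_measure_square
  by (intro integral_lebesgue_density) (auto intro!: borel_Times)

lemma integral_unit_cube:
  fixes F G :: "real \<times> real \<times> real \<Rightarrow> real"
  assumes "F \<in> borel_measurable (unit_measure \<Otimes>\<^sub>M (unit_measure \<Otimes>\<^sub>M unit_measure))"
    and "AE p in unit_measure \<Otimes>\<^sub>M (unit_measure \<Otimes>\<^sub>M unit_measure). G p = F p"
  shows "(LINT p:\<I> \<times> \<I> \<times> \<I>|lebesgue. G p) =
    (\<integral>p. F p \<partial>(unit_measure \<Otimes>\<^sub>M (unit_measure \<Otimes>\<^sub>M unit_measure)))"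
  using assms unfolding unit_measure_cube
  by (intro integral_lebesgue_density) (auto intro!: borel_Times)

text \<open>A graphon is only Lebesgue measurable on the square, so Fubini's theorem is applied to a
  Borel version of it.\<close>

definition borel_version :: "(real \<Rightarrow> real \<Rightarrow> real) \<Rightarrow> (real \<Rightarrow> real \<Rightarrow> real) \<Rightarrow> bool" where
  "borel_version W V \<longleftrightarrow> symmetric_kernel unit_measure V \<and>
     (AE (x, y) in unit_measure \<Otimes>\<^sub>M unit_measure. W x y = V x y)"

lemma borel_version_exists:
  assumes "graphon W"
  obtains V where "borel_version W V"
proof -
  let ?P = "unit_measure \<Otimes>\<^sub>M unit_measure"
  have WI: "W x y = W y x" "0 \<le> W x y" "W x y \<le> 1" if "x \<in> \<I>" "y \<in> \<I>" for x y
    using assms that by (auto simp: graphon_def)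
  define f where "f = (\<lambda>p. if p \<in> \<I> \<times> \<I> then case_prod W p else 0)"
  have "f \<in> borel_measurable lebesgue"
    unfolding f_def using assms lebesgue_Times(1)[of \<I> \<I>]
    by (subst borel_measurable_if) (auto simp: graphon_def)
  then obtain g where [measurable]: "g \<in> borel_measurable lborel" and ae: "AE p in lborel. f p = g p"
    using completion_ex_borel_measurable_real by blast
  have [measurable]: "g \<in> borel_measurable (borel \<Otimes>\<^sub>M borel)" by (simp add: borel_prod)
  have I: "AE p in ?P. p \<in> \<I> \<times> \<I>"
    unfolding unit_measure_square by (subst AE_density) (auto simp: indicator_def)
  have "AE p in ?P. f p = g p"
    unfolding unit_measure_square using ae by (subst AE_density) (auto elim!: AE_mp)
  with I have ae1: "AE p in ?P. p \<in> \<I> \<times> \<I> \<and> case_prod W p = g p"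
    by eventually_elim (auto simp: f_def)
  \<comment> \<open>The product measure is invariant under swapping coordinates, so the agreement
    also holds at the transposed point.\<close>
  have "AE p in distr ?P ?P (\<lambda>(x, y). (y, x)). p \<in> \<I> \<times> \<I> \<and> case_prod W p = g p"
    using ae1 by (subst U2.distr_pair_swap[symmetric])
  then have ae2: "AE p in ?P. (snd p, fst p) \<in> \<I> \<times> \<I> \<and> W (snd p) (fst p) = g (snd p, fst p)"
    by (drule_tac AE_distrD[rotated]) (auto simp: split_beta')
  \<comment> \<open>Averaging with the transpose and clipping enforce symmetry and range everywhere;
    where \<open>g\<close> agrees with \<open>W\<close> at both points they change nothing.\<close>
  define V where "V x y = max 0 (min 1 ((g (x, y) + g (y, x)) / 2))" for x y
  have "symmetric_kernel unit_measure V"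
  proof
    show "case_prod V \<in> borel_measurable ?P" unfolding V_def by measurable
  qed (auto simp: V_def add.commute)
  moreover have "AE (x, y) in ?P. W x y = V x y"
    using ae1 ae2
  proof eventually_elim
    case (elim p)
    obtain x y where p: "p = (x, y)" by force
    with elim have "x \<in> \<I>" "y \<in> \<I>" "g (x, y) = W x y" "g (y, x) = W y x" by auto
    then show ?case using WI[of x y] by (simp add: V_def p)
  qed
  ultimately show thesis using that by (simp add: borel_version_def)
qed

text \<open>Each of the three projections from the cube to the square pulls null sets back to null
  sets. For the pairs containing \<open>x\<close> this holds because almost every section of a null
  set is null.\<close>

lemma AE_unit_cube:
  assumes "AE (x, y) in unit_measure \<Otimes>\<^sub>M unit_measure. P x y"
  shows "AE (x, y, z) in unit_measure \<Otimes>\<^sub>M (unit_measure \<Otimes>\<^sub>M unit_measure). P x y \<and> P x z \<and> P y z"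
proof -
  let ?P = "unit_measure \<Otimes>\<^sub>M unit_measure"
  obtain N where N: "N \<in> null_sets ?P" "\<And>x y. \<not> P x y \<Longrightarrow> (x, y) \<in> N"
    using assms by (auto simp: eventually_ae_filter space_pair_measure)
  have [measurable]: "N \<in> sets ?P" using N by auto
  have 2: "AE p in ?P. p \<notin> N" using N(1) by (rule AE_not_in)
  then have 1: "AE x in unit_measure. AE y in unit_measure. (x, y) \<notin> N"
    by (rule U2.AE_pair)
  have "AE (x, y, z) in unit_measure \<Otimes>\<^sub>M ?P. (x, y) \<notin> N \<and> (x, z) \<notin> N \<and> (y, z) \<notin> N"
  proof (rule U3.AE_pair_measure)
    show "{p \<in> space (unit_measure \<Otimes>\<^sub>M ?P). case p of (x, y, z) \<Rightarrow> (x, y) \<notin> N \<and> (x, z) \<notin> N \<and> (y, z) \<notin> N} \<in> sets (unit_measure \<Otimes>\<^sub>M ?P)"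
      by measurable
    show "AE x in unit_measure. AE q in ?P. case (x, q) of (x, y, z) \<Rightarrow> (x, y) \<notin> N \<and> (x, z) \<notin> N \<and> (y, z) \<notin> N"
      using 1
    proof eventually_elim
      case (elim x)
      have "AE q in ?P. (x, fst q) \<notin> N"
        by (rule U2.AE_pair_measure) (use elim in \<open>auto elim: AE_mp\<close>)
      moreover have "AE q in ?P. (x, snd q) \<notin> N"
        by (rule U2.AE_pair_measure) (use elim in \<open>auto elim: AE_mp\<close>)
      ultimately show ?case using 2 by eventually_elim auto
    qed
  qed
  then show ?thesis by eventually_elim (use N(2) in auto)
qed

lemma ind_wedge_density_borel_version:
  assumes "borel_version W V"
  shows "ind_wedge_density W = symmetric_kernel.wedge unit_measure V"
proof -
  interpret V: symmetric_kernel unit_measure V using assms by (simp add: borel_version_def)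
  have "AE (x, y, z) in unit_measure \<Otimes>\<^sub>M (unit_measure \<Otimes>\<^sub>M unit_measure). W x y = V x y \<and> W x z = V x z \<and> W y z = V y z"
    using assms by (intro AE_unit_cube) (simp add: borel_version_def)
  then show ?thesis unfolding ind_wedge_density_def V.wedge_def
    by (intro integral_unit_cube) (auto elim!: AE_mp)
qed

text \<open>Reduces the cut-norm estimates to L1 estimates on the product space, with
  \<open>v\<close> a Borel version of the kernel.\<close>

lemma cut_norm_le_L1:
  assumes "bounded_kernel f" "v \<in> borel_measurable (unit_measure \<Otimes>\<^sub>M unit_measure)"
    "AE p in unit_measure \<Otimes>\<^sub>M unit_measure. case_prod f p = v p"
  shows "cut_norm f \<le> (\<integral>p. \<bar>v p\<bar> \<partial>(unit_measure \<Otimes>\<^sub>M unit_measure))"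
proof (rule cut_norm_least)
  fix S T assume ST: "(S, T) \<in> square_sets"
  have I: "(\<I>, \<I>) \<in> square_sets" by simp
  have "\<bar>LINT (x, y):S \<times> T|lebesgue. f x y\<bar> \<le> (LINT p|lebesgue_on (\<I> \<times> \<I>). \<bar>indicator (S \<times> T) p * case_prod f p\<bar>)"
    unfolding set_integral_square[OF square_sets_subset[OF ST]] by (rule integral_abs_bound)
  also have "\<dots> \<le> (LINT p|lebesgue_on (\<I> \<times> \<I>). \<bar>indicator (\<I> \<times> \<I>) p * case_prod f p\<bar>)"
    using ST by (intro integral_mono integrable_abs bounded_kernel_integrable[OF assms(1)] I)
      (auto simp: indicator_def)
  also have "\<dots> = (LINT p:\<I> \<times> \<I>|lebesgue. \<bar>case_prod f p\<bar>)"
    by (subst set_integral_square) (auto simp: abs_mult)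
  also have "\<dots> = (\<integral>p. \<bar>v p\<bar> \<partial>(unit_measure \<Otimes>\<^sub>M unit_measure))"
    using assms by (intro integral_unit_square) (auto elim!: AE_mp)
  finally show "\<bar>LINT (x, y):S \<times> T|lebesgue. f x y\<bar> \<le> \<dots>" .
qed

section \<open>Bounds on the terms of the objective\<close>

text \<open>The square has measure 1. A non-integrable \<open>F\<close> is covered too: its integral
  is 0 by default, and \<open>c\<close> is nonnegative because it bounds
  \<open>\<bar>F (0, 0)\<bar>\<close>.\<close>

lemma set_integral_unit_square_abs_le:
  fixes F :: "real \<times> real \<Rightarrow> real"
  assumes "\<And>p. p \<in> \<I> \<times> \<I> \<Longrightarrow> \<bar>F p\<bar> \<le> c"
  shows "\<bar>LINT p:\<I> \<times> \<I>|lebesgue. F p\<bar> \<le> c"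
proof -
  let ?L = "lebesgue_on (\<I> \<times> \<I>)"
  interpret finite_measure ?L
    by (rule finite_measure_lebesgue_on) (rule unit_square_lmeasurable)
  have II: "\<I> \<times> \<I> \<in> sets lebesgue" "emeasure lebesgue (\<I> \<times> \<I>) = 1"
    using lebesgue_Times[of \<I> \<I>] by auto
  have "emeasure ?L (\<I> \<times> \<I>) = emeasure lebesgue (\<I> \<times> \<I>)"
    by (rule emeasure_restrict_space) (use II(1) in auto)
  then have m: "measure ?L (space ?L) = 1"
    unfolding II(2) by (simp add: measure_def)
  have "\<bar>F (0, 0)\<bar> \<le> c" by (rule assms) simp
  then have c: "0 \<le> c" by linarith
  have e: "(LINT p:\<I> \<times> \<I>|lebesgue. F p) = (LINT p|?L. F p)"
    by (subst set_integral_square) (auto intro!: Bochner_Integration.integral_cong)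
  show ?thesis
  proof (cases "integrable ?L F")
    case True
    have "\<bar>LINT p|?L. F p\<bar> \<le> (LINT p|?L. \<bar>F p\<bar>)" by (rule integral_abs_bound)
    also have "\<dots> \<le> (LINT p|?L. c)"
      using True assms by (intro integral_mono) auto
    also have "\<dots> = c" using m by simp
    finally show ?thesis by (simp add: e)
  qed (simp add: e not_integrable_integral_eq c)
qed

lemma edge_density_abs_le: "graphon W \<Longrightarrow> \<bar>edge_density W\<bar> \<le> 1"
  unfolding edge_density_def
  by (rule set_integral_unit_square_abs_le) (auto simp: graphon_def)

lemma abs_mult_ln_le: "\<bar>w * ln w\<bar> \<le> 1" if "0 \<le> w" "w \<le> 1" for w :: real
proof (cases "w = 0")
  case False
  then have w: "0 < w" using that by simp
  \<comment> \<open>Taking \<open>t = 1 / w\<close> in \<open>ln t \<le> t - 1\<close> avoids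
    maximizing \<open>- w * ln w\<close>, whose true maximum is \<open>1/e\<close>.\<close>
  have "- ln w \<le> 1 / w - 1" using ln_le_minus_one[of "1/w"] w by (simp add: ln_div)
  then have "w * (- ln w) \<le> w * (1 / w - 1)" using w by (intro mult_left_mono) auto
  also have "\<dots> \<le> 1" using w by (simp add: algebra_simps)
  finally have "- (w * ln w) \<le> 1" by simp
  moreover have "w * ln w \<le> 0" using w that by (intro mult_nonneg_nonpos) auto
  ultimately show ?thesis by linarith
qed simp

lemma graphon_entropy_abs_le: "graphon W \<Longrightarrow> \<bar>graphon_entropy W\<bar> \<le> 2"
  unfolding graphon_entropy_def
proof (rule set_integral_unit_square_abs_le, clarify)
  fix x y :: real assume "graphon W" and xy: "x \<in> \<I>" "y \<in> \<I>"
  then have "0 \<le> W x y" "W x y \<le> 1" by (auto simp: graphon_def)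
  then show "\<bar>W x y * ln (W x y) + (1 - W x y) * ln (1 - W x y)\<bar> \<le> 2"
    using abs_mult_ln_le[of "W x y"] abs_mult_ln_le[of "1 - W x y"] by linarith
qed

lemma ind_wedge_density_le: "graphon W \<Longrightarrow> ind_wedge_density W \<le> 1/4"
proof -
  assume "graphon W"
  then obtain V where V: "borel_version W V" by (rule borel_version_exists)
  then interpret V: symmetric_kernel unit_measure V by (simp add: borel_version_def)
  show ?thesis
    using V.wedge_le zero_le_power2[of "V.edges - 1/2"]
    unfolding ind_wedge_density_borel_version[OF V] by linarith
qed

section \<open>The balanced bipartite graphon\<close>

text \<open>The complete bipartite kernel with its sides separated at \<open>c\<close>. For
  \<open>c = 1/2\<close> it differs from \<open>W_bip\<close> on the unit square only where a
  coordinate equals 1/2.\<close>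

definition split_kernel :: "real \<Rightarrow> real \<Rightarrow> real \<Rightarrow> real" where
  "split_kernel c = bip_kernel (indicator {..<c})"

lemma indicator_unit: "0 \<le> indicat_real S x \<and> indicat_real S x \<le> 1"
  by (simp split: split_indicator)

lemma bip_kernel_measurable [measurable]:
  assumes [measurable]: "f \<in> borel_measurable M" "u \<in> N \<rightarrow>\<^sub>M M" "v \<in> N \<rightarrow>\<^sub>M M"
  shows "(\<lambda>p. bip_kernel f (u p) (v p)) \<in> borel_measurable N"
  unfolding bip_kernel_def by measurable

lemma symmetric_kernel_bip_kernel:
  assumes "f \<in> borel_measurable borel" "\<And>x. 0 \<le> f x \<and> f x \<le> 1"
  shows "symmetric_kernel unit_measure (bip_kernel f)"
proof
  have [measurable]: "f \<in> borel_measurable unit_measure" using assms(1) by (simp add: unit_measure_def)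
  show "case_prod (bip_kernel f) \<in> borel_measurable (unit_measure \<Otimes>\<^sub>M unit_measure)"
    by (simp add: split_beta' bip_kernel_measurable)
  show "bip_kernel f x y = bip_kernel f y x" for x y by (simp add: bip_kernel_def)
  show "0 \<le> bip_kernel f x y \<and> bip_kernel f x y \<le> 1" for x y
    using bip_kernel_unit[of f x y] assms(2) by auto
qed

lemma symmetric_kernel_split_kernel: "symmetric_kernel unit_measure (split_kernel c)"
  unfolding split_kernel_def by (rule symmetric_kernel_bip_kernel) (auto simp: indicator_unit)

lemma AE_unit_square_neq: "AE (x, y) in unit_measure \<Otimes>\<^sub>M unit_measure. x \<noteq> c \<and> y \<noteq> c"
proof -
  have *: "AE x in unit_measure. x \<noteq> c"
    unfolding unit_measure_def
    using AE_lborel_singleton[of c] by (subst AE_density) (auto elim: AE_mp)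
  show ?thesis
    by (rule U2.AE_pair_measure) (use * in \<open>auto elim!: AE_mp\<close>)
qed

lemma borel_version_W_bip: "borel_version W_bip (split_kernel (1/2))"
proof -
  let ?P = "unit_measure \<Otimes>\<^sub>M unit_measure"
  have I: "AE p in ?P. p \<in> \<I> \<times> \<I>"
    unfolding unit_measure_square by (subst AE_density) (auto simp: indicator_def)
  have "AE (x, y) in ?P. W_bip x y = split_kernel (1/2) x y"
    using I AE_unit_square_neq[of "1/2"]
    by eventually_elim (auto simp: W_bip_def split_kernel_def bip_kernel_def indicator_def)
  then show ?thesis using symmetric_kernel_split_kernel by (simp add: borel_version_def)
qed

lemma expectation_indicator_lessThan:
  assumes "0 \<le> c" "c \<le> 1"
  shows "(\<integral>x. indicator {..<c} x \<partial>unit_measure) = c"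
proof -
  have "{..<c} \<inter> \<I> = {0..<c}" using assms by auto
  then have "emeasure unit_measure {..<c} = ennreal c"
    using assms by (simp add: unit_measure_def emeasure_density indicator_inter_arith[symmetric] Int_commute)
  then show ?thesis using assms by (simp add: measure_def)
qed

text \<open>Every degree is 1/2, and there is no lone edge: given an edge across the two sides, a
  third vertex is joined to whichever endpoint lies opposite. The identity for
  \<open>wedge + lone_edge\<close> then gives the value.\<close>

lemma ind_wedge_density_W_bip: "ind_wedge_density W_bip = 1/4"
proof -
  interpret V: symmetric_kernel unit_measure "split_kernel (1/2)" by (rule symmetric_kernel_split_kernel)
  have i: "integrable unit_measure (indicator {..<1/2} :: real \<Rightarrow> real)"
    by (intro U.integrable_bounded[of _ 1]) auto
  have "V.degree x = 1/2" for x
    unfolding V.degree_def unfolding split_kernel_def bip_kernel_def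
    using i expectation_indicator_lessThan[of "1/2"] U.prob_space by (simp add: algebra_simps)
  then have "V.degree = (\<lambda>_. 1/2)" by blast
  then have "V.wedge + V.lone_edge = 1/4"
    unfolding V.wedge_plus_lone_edge by (simp add: U.prob_space[simplified] power2_eq_square)
  moreover have "V.lone_edge = 0"
  proof -
    have "split_kernel (1/2) x y * (1 - split_kernel (1/2) x z) * (1 - split_kernel (1/2) y z) = 0" for x y z
      by (auto simp: split_kernel_def bip_kernel_def indicator_def)
    then show ?thesis unfolding V.lone_edge_def by (simp only: split_beta') simp
  qed
  ultimately show ?thesis by (simp add: ind_wedge_density_borel_version[OF borel_version_W_bip])
qed

section \<open>Growth of the optimal value\<close>

text \<open>The edge term contributes \<open>\<bar>\<beta>1\<bar>\<close> and half the entropy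
  contributes 1.\<close>

lemma wedge_objective_bounds:
  assumes "graphon W"
  shows "\<bar>wedge_objective \<beta>1 \<beta>2 W - \<beta>2 * ind_wedge_density W\<bar> \<le> \<bar>\<beta>1\<bar> + 1"
proof -
  have "\<bar>\<beta>1 * edge_density W\<bar> \<le> \<bar>\<beta>1\<bar> * 1"
    unfolding abs_mult using edge_density_abs_le[OF assms] by (intro mult_left_mono) auto
  then show ?thesis
    using graphon_entropy_abs_le[OF assms] unfolding wedge_objective_def by linarith
qed

lemma wedge_objective_le:
  assumes "graphon W" "0 \<le> \<beta>2"
  shows "wedge_objective \<beta>1 \<beta>2 W \<le> \<bar>\<beta>1\<bar> + 1 + \<beta>2 / 4"
proof -
  have "\<beta>2 * ind_wedge_density W \<le> \<beta>2 * (1/4)"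
    using ind_wedge_density_le[OF assms(1)] assms(2) by (intro mult_left_mono)
  then show ?thesis using wedge_objective_bounds[OF assms(1), of \<beta>1 \<beta>2] by linarith
qed

lemma wedge_objective_W_bip_ge: "\<beta>2 / 4 - (\<bar>\<beta>1\<bar> + 1) \<le> wedge_objective \<beta>1 \<beta>2 W_bip"
  using wedge_objective_bounds[OF graphon_W_bip, of \<beta>1 \<beta>2] unfolding ind_wedge_density_W_bip by linarith

text \<open>The lower bound comes from \<open>W_bip\<close> as a competitor, the upper bound from
  the wedge density being at most 1/4 for every graphon.\<close>

lemma psi_wedge_bounds:
  assumes "0 < \<beta>2"
  shows "\<bar>psi_wedge \<beta>1 \<beta>2 / \<beta>2 - 1/4\<bar> \<le> (\<bar>\<beta>1\<bar> + 1) / \<beta>2"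
proof -
  let ?S = "wedge_objective \<beta>1 \<beta>2 ` {W. graphon W}"
  have "bdd_above ?S" using wedge_objective_le assms by (intro bdd_aboveI2[of _ _ "\<bar>\<beta>1\<bar> + 1 + \<beta>2 / 4"]) auto
  then have "wedge_objective \<beta>1 \<beta>2 W_bip \<le> Sup ?S"
    using graphon_W_bip by (intro cSUP_upper) auto
  moreover have "Sup ?S \<le> \<bar>\<beta>1\<bar> + 1 + \<beta>2 / 4"
    using graphon_W_bip wedge_objective_le assms by (intro cSUP_least) auto
  ultimately have "\<bar>psi_wedge \<beta>1 \<beta>2 - \<beta>2 / 4\<bar> \<le> \<bar>\<beta>1\<bar> + 1"
    using wedge_objective_W_bip_ge[of \<beta>2 \<beta>1] unfolding psi_wedge_def Union_graphon_space by linarith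
  then have "\<bar>psi_wedge \<beta>1 \<beta>2 - \<beta>2 / 4\<bar> / \<beta>2 \<le> (\<bar>\<beta>1\<bar> + 1) / \<beta>2"
    using assms by (intro divide_right_mono) auto
  also have "\<bar>psi_wedge \<beta>1 \<beta>2 - \<beta>2 / 4\<bar> / \<beta>2 = \<bar>psi_wedge \<beta>1 \<beta>2 / \<beta>2 - 1/4\<bar>"
    using assms by (simp add: abs_div_pos diff_divide_distrib)
  finally show ?thesis .
qed

lemma psi_wedge_limit: "((\<lambda>\<beta>2. psi_wedge \<beta>1 \<beta>2 / \<beta>2) \<longlongrightarrow> 1/4) at_top"
proof (rule tendsto_rabs_zero_cancel[THEN LIM_zero_cancel])
  show "((\<lambda>\<beta>2. \<bar>psi_wedge \<beta>1 \<beta>2 / \<beta>2 - 1/4\<bar>) \<longlongrightarrow> 0) at_top"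
  proof (rule tendsto_sandwich[where f = "\<lambda>_. 0"])
    show "\<forall>\<^sub>F \<beta>2 in at_top. \<bar>psi_wedge \<beta>1 \<beta>2 / \<beta>2 - 1/4\<bar> \<le> (\<bar>\<beta>1\<bar> + 1) / \<beta>2"
      using eventually_gt_at_top[of 0] by eventually_elim (rule psi_wedge_bounds)
    show "((\<lambda>\<beta>2. (\<bar>\<beta>1\<bar> + 1) / \<beta>2) \<longlongrightarrow> 0) at_top"
      by (rule tendsto_divide_0[OF tendsto_const filterlim_at_top_imp_at_infinity[OF filterlim_ident]])
  qed auto
qed

section \<open>Block permutations\<close>

text \<open>On the unit interval the point 1 alone forms block number \<open>n\<close>, which \<open>\<pi>\<close> is meant to fix.\<close>

definition block_map :: "nat \<Rightarrow> (nat \<Rightarrow> nat) \<Rightarrow> real \<Rightarrow> real" where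
  "block_map n \<pi> x = x + (real (\<pi> (nat \<lfloor>n * x\<rfloor>)) - real (nat \<lfloor>n * x\<rfloor>)) / n"

lemma block_le: "x \<in> \<I> \<Longrightarrow> nat \<lfloor>n * x\<rfloor> \<le> n"
proof -
  assume "x \<in> \<I>"
  then have "real n * x \<le> real n * 1" by (intro mult_left_mono) auto
  then show ?thesis by linarith
qed

lemma block_map_block:
  assumes "0 < n" "\<pi> permutes {..<n}" "x \<in> \<I>"
  shows "block_map n \<pi> x \<in> \<I>" "nat \<lfloor>n * block_map n \<pi> x\<rfloor> = \<pi> (nat \<lfloor>n * x\<rfloor>)"
proof -
  define i where "i = nat \<lfloor>n * x\<rfloor>"
  have i: "i \<le> n" using block_le[OF assms(3)] by (simp add: i_def)
  have "0 \<le> real n * x" using assms by simp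
  then have x: "real i \<le> n * x" "n * x < real i + 1" unfolding i_def by linarith+
  have bm: "block_map n \<pi> x = x + (real (\<pi> i) - real i) / n" by (simp add: block_map_def i_def)
  then have e: "n * block_map n \<pi> x = (n * x - i) + \<pi> i"
    using assms(1) bm by (simp add: field_simps)
  then show "nat \<lfloor>n * block_map n \<pi> x\<rfloor> = \<pi> (nat \<lfloor>n * x\<rfloor>)"
    using x unfolding i_def[symmetric] by linarith
  show "block_map n \<pi> x \<in> \<I>"
  proof (cases "i = n")
    case True
    then have "\<pi> i = i" using assms(2) by (auto simp: permutes_def)
    then have "block_map n \<pi> x = x" by (simp add: block_map_def i_def)
    then show ?thesis using assms by simp
  next
    case False
    then have "\<pi> i < n" using i permutes_in_image[OF assms(2), of i] by simp
    then have "0 \<le> n * block_map n \<pi> x \<and> n * block_map n \<pi> x \<le> n * 1"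
      using e x by simp
    then show ?thesis using assms(1) by (simp add: zero_le_mult_iff)
  qed
qed

lemma block_map_inverse:
  assumes "0 < n" "\<pi> permutes {..<n}" "x \<in> \<I>"
  shows "block_map n (inv \<pi>) (block_map n \<pi> x) = x"
proof -
  let ?i = "nat \<lfloor>n * x\<rfloor>"
  have "block_map n (inv \<pi>) (block_map n \<pi> x) = block_map n \<pi> x + (real ?i - real (\<pi> ?i)) / n"
    unfolding block_map_def[of n "inv \<pi>"] block_map_block(2)[OF assms] permutes_inverses(2)[OF assms(2)] ..
  also have "\<dots> = x" by (simp add: block_map_def diff_divide_distrib)
  finally show ?thesis .
qed

text \<open>The measure is computed block by block because a block map is a translation on each
  block. The index \<open>n\<close> is included for the point 1.\<close>

lemma measure_block_split:
  fixes A :: "real set" and n :: nat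
  assumes A: "A \<in> sets lebesgue" "A \<subseteq> \<I>"
  shows "A \<inter> {x. nat \<lfloor>n * x\<rfloor> = i} \<in> lmeasurable"
    "measure lebesgue A = (\<Sum>i\<le>n. measure lebesgue (A \<inter> {x. nat \<lfloor>n * x\<rfloor> = i}))"
proof -
  have "{x \<in> space borel. nat \<lfloor>real n * (x :: real)\<rfloor> = i} \<in> sets borel" for i by measurable
  then have b: "{x. nat \<lfloor>real n * x\<rfloor> = i} \<in> sets lebesgue" for i by simp
  have bA: "bounded A" using A(2) by (rule bounded_subset[rotated]) auto
  show m: "A \<inter> {x. nat \<lfloor>n * x\<rfloor> = i} \<in> lmeasurable" for i
    using bA by (intro bounded_set_imp_lmeasurable sets.Int A(1) b) (auto intro: bounded_subset)
  have "A = (\<Union>i\<le>n. A \<inter> {x. nat \<lfloor>n * x\<rfloor> = i})" using A(2) block_le[of _ n] by auto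
  then have "measure lebesgue A = measure lebesgue (\<Union>i\<le>n. A \<inter> {x. nat \<lfloor>n * x\<rfloor> = i})" by simp
  also have "\<dots> = (\<Sum>i\<le>n. measure lebesgue (A \<inter> {x. nat \<lfloor>n * x\<rfloor> = i}))"
    by (rule measure_UNION') (auto simp: m pairwise_def disjnt_def)
  finally show "measure lebesgue A = (\<Sum>i\<le>n. measure lebesgue (A \<inter> {x. nat \<lfloor>n * x\<rfloor> = i}))" .
qed

text \<open>A preimage is a finite union of translated pieces, one per block, and the permutation
  only reorders the summands of the measure.\<close>

lemma block_map_mp_bijections:
  assumes "0 < n" "\<pi> permutes {..<n}"
  shows "block_map n \<pi> \<in> mp_bijections"
proof (rule mp_bijectionsI)
  note inv = permutes_inv[OF assms(2)]
  show bij: "bij_betw (block_map n \<pi>) \<I> \<I>"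
  proof (rule bij_betwI[where g = "block_map n (inv \<pi>)"])
    show "block_map n \<pi> \<in> \<I> \<rightarrow> \<I>" "block_map n (inv \<pi>) \<in> \<I> \<rightarrow> \<I>"
      using block_map_block(1)[OF assms] block_map_block(1)[OF assms(1) inv] by auto
    show "block_map n (inv \<pi>) (block_map n \<pi> x) = x" if "x \<in> \<I>" for x
      using block_map_inverse[OF assms that] .
    show "block_map n \<pi> (block_map n (inv \<pi>) x) = x" if "x \<in> \<I>" for x
      using block_map_inverse[OF assms(1) inv that] by (simp add: permutes_inv_inv[OF assms(2)])
  qed
  fix A :: "real set" assume A: "A \<in> sets lebesgue" "A \<subseteq> \<I>"
  let ?V = "block_map n \<pi> -` A \<inter> \<I>" and ?cell = "\<lambda>i. {x. nat \<lfloor>real n * x\<rfloor> = i}"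
  define s where "s i = (real (\<pi> i) - real i) / n" for i
  have cell: "?V \<inter> ?cell i = (\<lambda>y. y - s i) ` (A \<inter> ?cell (\<pi> i))" for i
  proof (intro set_eqI iffI)
    fix x assume x: "x \<in> ?V \<inter> ?cell i"
    show "x \<in> (\<lambda>y. y - s i) ` (A \<inter> ?cell (\<pi> i))"
    proof (rule image_eqI)
      show "x = block_map n \<pi> x - s i" using x by (auto simp: block_map_def s_def)
      show "block_map n \<pi> x \<in> A \<inter> ?cell (\<pi> i)" using x block_map_block(2)[OF assms, of x] by auto
    qed
  next
    fix x assume "x \<in> (\<lambda>y. y - s i) ` (A \<inter> ?cell (\<pi> i))"
    then obtain y :: real where y: "x = y - s i" "y \<in> A" "nat \<lfloor>n * y\<rfloor> = \<pi> i" by auto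
    have yI: "y \<in> \<I>" using y A by auto
    have ix: "inv \<pi> (\<pi> i) = i" using permutes_inverses(2)[OF assms(2)] by simp
    have "x = block_map n (inv \<pi>) y"
      by (simp add: block_map_def y ix s_def) (simp add: field_simps diff_divide_distrib)
    then show "x \<in> ?V \<inter> ?cell i"
      using block_map_block[OF assms(1) inv yI] block_map_inverse[OF assms(1) inv yI] y ix
      by (simp add: permutes_inv_inv[OF assms(2)])
  qed
  have V: "(\<Union>i\<le>n. ?V \<inter> ?cell i) = ?V"
  proof (intro equalityI subsetI)
    fix x assume "x \<in> ?V"
    then show "x \<in> (\<Union>i\<le>n. ?V \<inter> ?cell i)"
      using block_le[of x n] by (intro UN_I[of "nat \<lfloor>n * x\<rfloor>"]) auto
  qed blast
  have "(\<lambda>y. y - s i) ` (A \<inter> ?cell (\<pi> i)) \<in> sets lebesgue" for i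
    by (intro fmeasurableD measurable_translation_subtract measure_block_split(1) A)
  then have "(\<Union>i\<le>n. ?V \<inter> ?cell i) \<in> sets lebesgue"
    unfolding cell by (intro sets.finite_UN) auto
  then show Vm: "?V \<in> sets lebesgue" by (simp only: V)
  have fin: "X \<in> lmeasurable" if "X \<in> sets lebesgue" "X \<subseteq> \<I>" for X
    using that by (intro bounded_set_imp_lmeasurable) (auto intro: bounded_subset[of \<I>])
  \<comment> \<open>The sum includes block \<open>n\<close>, which \<open>\<pi>\<close> fixes, so it
    can still be reindexed.\<close>
  have "\<pi> permutes {..n}" using assms(2) by (rule permutes_subset) auto
  then have "bij_betw \<pi> {..n} {..n}" by (rule permutes_imp_bij)
  then have "(\<Sum>i\<le>n. measure lebesgue (A \<inter> ?cell (\<pi> i))) = (\<Sum>i\<le>n. measure lebesgue (A \<inter> ?cell i))"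
    by (rule sum.reindex_bij_betw)
  then have "(\<Sum>i\<le>n. measure lebesgue (?V \<inter> ?cell i)) = (\<Sum>i\<le>n. measure lebesgue (A \<inter> ?cell i))"
    by (simp only: cell measure_translation_subtract)
  then have "measure lebesgue ?V = measure lebesgue A"
    by (simp only: measure_block_split(2)[OF Vm Int_lower2, of n, symmetric] measure_block_split(2)[OF A, of n, symmetric])
  then show "emeasure lebesgue ?V = emeasure lebesgue A"
    using emeasure_eq_measure2[OF fin[OF Vm Int_lower2]] emeasure_eq_measure2[OF fin[OF A]] by (simp only:)
qed

lemma permutation_to_initial_segment:
  assumes "S \<subseteq> {..<n}"
  obtains \<pi> where "\<pi> permutes {..<n}" "\<And>i. i < n \<Longrightarrow> \<pi> i < card S \<longleftrightarrow> i \<in> S"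
proof -
  have fS: "finite S" using assms finite_subset by auto
  have cS: "card S \<le> n" using card_mono[OF _ assms] by simp
  obtain f where f: "bij_betw f S {..<card S}"
    using finite_same_card_bij[OF fS, of "{..<card S}"] by auto
  have "card ({..<n} - S) = card {card S..<n}" using assms fS by (simp add: card_Diff_subset)
  then obtain g where g: "bij_betw g ({..<n} - S) {card S..<n}"
    using finite_same_card_bij[of "{..<n} - S" "{card S..<n}"] by auto
  define \<pi> where "\<pi> i = (if i \<in> S then f i else if i < n then g i else i)" for i
  have b1: "bij_betw \<pi> S {..<card S}" using f by (rule bij_betw_cong[THEN iffD1, rotated]) (simp add: \<pi>_def)
  have b2: "bij_betw \<pi> ({..<n} - S) {card S..<n}" using g by (rule bij_betw_cong[THEN iffD1, rotated]) (simp add: \<pi>_def)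
  have "bij_betw \<pi> (S \<union> ({..<n} - S)) ({..<card S} \<union> {card S..<n})"
    using b1 b2 by (rule bij_betw_combine) auto
  moreover have "S \<union> ({..<n} - S) = {..<n}" "{..<card S} \<union> {card S..<n} = {..<n}" using assms cS by auto
  ultimately have "bij_betw \<pi> {..<n} {..<n}" by simp
  then have "\<pi> permutes {..<n}"
    by (rule bij_imp_permutes) (use assms in \<open>auto simp: \<pi>_def\<close>)
  moreover have "\<pi> i < card S \<longleftrightarrow> i \<in> S" if "i < n" for i
    using bij_betwE[OF b1] bspec[OF bij_betwE[OF b2], of i] that by (cases "i \<in> S") auto
  ultimately show thesis by (rule that)
qed

text \<open>A permutation listing \<open>S\<close> first carries the union of its blocks to the
  interval from 0 to \<open>c = card S / n\<close>. The equivalence is exact at every point, so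
  kernels can be compared pointwise.\<close>

lemma rearrange_blocks:
  assumes "0 < n" "S \<subseteq> {..<n}"
  obtains \<phi> c where "\<phi> \<in> mp_bijections" "0 \<le> c" "c \<le> 1"
    "\<And>x. x \<in> \<I> \<Longrightarrow> \<phi> x < c \<longleftrightarrow> nat \<lfloor>n * x\<rfloor> \<in> S"
proof -
  obtain \<pi> where \<pi>: "\<pi> permutes {..<n}" "\<And>i. i < n \<Longrightarrow> \<pi> i < card S \<longleftrightarrow> i \<in> S"
    using permutation_to_initial_segment[OF assms(2)] by blast
  have cS: "card S \<le> n" using card_mono[OF _ assms(2)] by simp
  \<comment> \<open>At \<open>i = n\<close>, the block of the point 1, both sides are false:
    \<open>\<pi>\<close> fixes \<open>n\<close>, and \<open>card S \<le> n\<close>.\<close>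
  have \<pi>': "\<pi> i < card S \<longleftrightarrow> i \<in> S" if "i \<le> n" for i
  proof (cases "i = n")
    case True
    then show ?thesis using \<pi>(1) cS assms(2) by (auto simp: permutes_def)
  qed (use \<pi>(2) that in auto)
  show thesis
  proof (rule that[of "block_map n \<pi>" "card S / n"])
    show "block_map n \<pi> \<in> mp_bijections" using assms(1) \<pi>(1) by (rule block_map_mp_bijections)
    fix x :: real assume x: "x \<in> \<I>"
    have "0 \<le> n * block_map n \<pi> x" using block_map_block(1)[OF assms(1) \<pi>(1) x] by simp
    then have "block_map n \<pi> x < card S / n \<longleftrightarrow> nat \<lfloor>n * block_map n \<pi> x\<rfloor> < card S"
      using assms(1) by (simp add: pos_less_divide_eq mult.commute nat_less_iff floor_less_iff)
    then show "block_map n \<pi> x < card S / n \<longleftrightarrow> nat \<lfloor>n * x\<rfloor> \<in> S"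
      using block_map_block(2)[OF assms(1) \<pi>(1) x] \<pi>'[OF block_le[OF x]] by simp
  qed (use assms(1) cS in auto)
qed

section \<open>Approximation of sets by unions of blocks\<close>

lemma expectation_indicator_unit_le:
  assumes "X \<in> sets borel" "emeasure lborel X \<le> ennreal e" "0 \<le> e"
  shows "(\<integral>x. indicat_real X x \<partial>unit_measure) \<le> e"
proof -
  have "emeasure unit_measure X = (\<integral>\<^sup>+x. indicator \<I> x * indicator X x \<partial>lborel)"
    using assms(1) by (simp add: unit_measure_def emeasure_density)
  also have "\<dots> \<le> (\<integral>\<^sup>+x. indicator X x \<partial>lborel)"
    by (intro nn_integral_mono) (simp add: indicator_def)
  also have "\<dots> \<le> ennreal e" using assms by simp
  finally have "measure unit_measure X \<le> e"
    unfolding measure_def using assms(3) by (rule enn2real_leI[rotated])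
  then show ?thesis
    by (simp only: Bochner_Integration.integral_indicator space_unit_measure Int_UNIV_right)
qed

text \<open>Not restricted to the unit interval: negative numbers fall into block 0 because
  \<open>nat\<close> truncates. They are null for \<open>unit_measure\<close>.\<close>

definition blocks :: "nat \<Rightarrow> nat set \<Rightarrow> real set" where
  "blocks n S = {x. nat \<lfloor>n * x\<rfloor> \<in> S}"

lemma blocks_measurable [measurable]: "blocks n S \<in> sets borel"
proof -
  have "(\<lambda>x :: real. nat \<lfloor>real n * x\<rfloor>) \<in> borel \<rightarrow>\<^sub>M count_space UNIV" by measurable
  from measurable_sets[OF this, of S] show ?thesis
    by (simp add: blocks_def vimage_def)
qed

text \<open>Enclose the set between a compact \<open>K\<close> and an open \<open>G\<close>. If
  \<open>1 / n\<close> is less than the distance from \<open>K\<close> to the complement of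
  \<open>G\<close>, the blocks meeting \<open>K\<close> stay inside \<open>G\<close> on the unit
  interval, so their union differs from the set only within \<open>G - K\<close>.\<close>

lemma block_approximation:
  assumes [measurable]: "A \<in> sets borel" and "0 < \<eta>"
  obtains n S where "0 < n" "S \<subseteq> {..<n}"
    "(\<integral>x. \<bar>indicat_real A x - indicat_real (blocks n S) x\<bar> \<partial>unit_measure) \<le> \<eta>"
proof -
  \<comment> \<open>This discards the point 1, whose block \<open>n\<close> must not enter
    \<open>S\<close>, and all points outside the unit interval; together they are null.\<close>
  define A' where "A' = A \<inter> {0..<1}"
  have [measurable]: "A' \<in> sets borel" by (simp add: A'_def)
  have A'l: "A' \<in> sets lebesgue" by simp
  have \<eta>: "0 < \<eta>/2" using assms(2) by simp
  obtain K where K: "closed K" "K \<subseteq> A'" "A' - K \<in> lmeasurable" "emeasure lebesgue (A' - K) < ennreal (\<eta>/2)"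
    by (rule sets_lebesgue_inner_closed[OF A'l \<eta>])
  obtain G where G: "open G" "A' \<subseteq> G" "G - A' \<in> lmeasurable" "emeasure lebesgue (G - A') < ennreal (\<eta>/2)"
    by (rule sets_lebesgue_outer_open[OF A'l \<eta>])
  have "K \<subseteq> \<I>" using K(2) by (auto simp: A'_def)
  then have "bounded K" by (rule bounded_subset[OF bounded_closed_interval])
  with K(1) have "compact K" by (simp add: compact_eq_bounded_closed)
  moreover have "closed (- G)" "K \<inter> - G = {}" using G K by auto
  ultimately obtain d where d: "0 < d" "\<And>x y. x \<in> K \<Longrightarrow> y \<notin> G \<Longrightarrow> d \<le> dist x y"
    using separate_compact_closed[of K "- G"] by (metis ComplI)
  obtain n :: nat where n: "0 < n" "1 / n < d" using real_arch_inverse[of d] d(1) by (auto simp: inverse_eq_divide)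
  define S where "S = (\<lambda>x. nat \<lfloor>n * x\<rfloor>) ` K \<inter> {..<n}"
  have [measurable]: "K \<in> sets borel" "G \<in> sets borel" using K(1) G(1) by auto
  have ptwise: "\<bar>indicat_real A x - indicat_real (blocks n S) x\<bar>
      \<le> indicat_real (A' - K) x + indicat_real (G - A') x" if x: "0 \<le> x" "x < 1" for x
  proof -
    have xA: "x \<in> A \<longleftrightarrow> x \<in> A'" using x by (simp add: A'_def)
    have "real n * x < real n * 1" using x n(1) by (intro mult_strict_left_mono) auto
    then have lt: "nat \<lfloor>n * x\<rfloor> < n" using n(1) x by (simp add: nat_less_iff floor_less_iff)
    have 1: "nat \<lfloor>n * x\<rfloor> \<in> S" if "x \<in> K" using that lt by (auto simp: S_def)
    have 2: "x \<in> G" if S: "nat \<lfloor>n * x\<rfloor> \<in> S"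
    proof (rule ccontr)
      assume "x \<notin> G"
      obtain y :: real where y: "y \<in> K" "nat \<lfloor>n * x\<rfloor> = nat \<lfloor>n * y\<rfloor>" using S by (auto simp: S_def)
      have "0 \<le> y" using y(1) K(2) by (auto simp: A'_def)
      then have "0 \<le> n * y" "0 \<le> n * x" using x by simp_all
      then have "\<bar>n * x - n * y\<bar> < 1" using y(2) by linarith
      also have "\<bar>n * x - n * y\<bar> = n * \<bar>x - y\<bar>" by (simp add: abs_mult flip: right_diff_distrib)
      finally have "\<bar>x - y\<bar> < 1 / n" using n(1) by (simp add: field_simps)
      with d(2)[OF y(1) \<open>x \<notin> G\<close>] n(2) show False by (simp add: dist_real_def)
    qed
    show ?thesis using 1 2 xA K(2) G(2) by (auto simp: indicator_def blocks_def)
  qed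
  have "AE x in unit_measure. 0 \<le> x \<and> x < 1"
    unfolding unit_measure_def using AE_lborel_singleton[of 1]
    by (subst AE_density) (auto elim!: AE_mp simp: indicator_def)
  then have ae: "AE x in unit_measure. \<bar>indicat_real A x - indicat_real (blocks n S) x\<bar>
      \<le> indicat_real (A' - K) x + indicat_real (G - A') x"
    by eventually_elim (simp add: ptwise)
  have i: "integrable unit_measure (indicat_real X)" if "X \<in> sets borel" for X
    using that by (intro U.integrable_bounded[of _ 1]) (auto simp: unit_measure_def)
  have "(\<integral>x. \<bar>indicat_real A x - indicat_real (blocks n S) x\<bar> \<partial>unit_measure)
      \<le> (\<integral>x. indicat_real (A' - K) x + indicat_real (G - A') x \<partial>unit_measure)"
    by (intro integral_mono_AE ae integrable_abs Bochner_Integration.integrable_diff Bochner_Integration.integrable_add i) auto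
  also have "\<dots> = (\<integral>x. indicat_real (A' - K) x \<partial>unit_measure) + (\<integral>x. indicat_real (G - A') x \<partial>unit_measure)"
    by (intro Bochner_Integration.integral_add i) auto
  also have "\<dots> \<le> \<eta>/2 + \<eta>/2"
    using K(4) G(4) \<eta> by (intro add_mono expectation_indicator_unit_le) auto
  finally have "(\<integral>x. \<bar>indicat_real A x - indicat_real (blocks n S) x\<bar> \<partial>unit_measure) \<le> \<eta>"
    by simp
  moreover have "S \<subseteq> {..<n}" by (simp add: S_def)
  ultimately show thesis using that n(1) by blast
qed

section \<open>Convergence of the maximizers\<close>

lemma integrable_unit_le_1:
  fixes f :: "real \<Rightarrow> real"
  assumes "f \<in> borel_measurable unit_measure" "\<And>x. \<bar>f x\<bar> \<le> 1"
  shows "integrable unit_measure f"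
  using assms by (rule U.integrable_bounded)

lemma graphon_bip_kernel:
  assumes "f \<in> borel_measurable borel" "\<And>x. 0 \<le> f x \<and> f x \<le> 1"
  shows "graphon (bip_kernel f)"
proof -
  have [measurable]: "f \<in> borel_measurable borel" by fact
  have "(\<lambda>p. bip_kernel f (fst p) (snd p)) \<in> borel_measurable (borel :: (real \<times> real) measure)"
    unfolding borel_prod[symmetric] by measurable
  then have "(\<lambda>(x, y). bip_kernel f x y) \<in> borel_measurable (lebesgue_on (\<I> \<times> \<I>))"
    by (intro measurable_restrict_space1 measurable_completion) (simp add: split_beta')
  moreover have "bip_kernel f x y = bip_kernel f y x" for x y by (simp add: bip_kernel_def)
  ultimately show ?thesis
    using bip_kernel_unit[of f] assms(2) by (simp add: graphon_def)
qed

lemma bip_kernel_diff_le_1: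
  assumes "\<And>x. 0 \<le> f x \<and> f x \<le> 1" "\<And>x. 0 \<le> h x \<and> h x \<le> 1"
  shows "\<bar>bip_kernel f x y - bip_kernel h x y\<bar> \<le> 1"
  using bip_kernel_unit[of f x y, OF assms(1)] bip_kernel_unit[of h x y, OF assms(2)] by linarith

lemma bip_kernel_L1_le:
  assumes [measurable]: "f \<in> borel_measurable borel" "h \<in> borel_measurable borel"
    and f: "\<And>x. 0 \<le> f x \<and> f x \<le> 1" and h: "\<And>x. 0 \<le> h x \<and> h x \<le> 1"
  shows "(\<integral>p. \<bar>bip_kernel f (fst p) (snd p) - bip_kernel h (fst p) (snd p)\<bar> \<partial>(unit_measure \<Otimes>\<^sub>M unit_measure))
    \<le> 2 * (\<integral>x. \<bar>f x - h x\<bar> \<partial>unit_measure)"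
proof -
  let ?P = "unit_measure \<Otimes>\<^sub>M unit_measure"
  have [measurable]: "f \<in> borel_measurable unit_measure" "h \<in> borel_measurable unit_measure"
    by (simp_all add: unit_measure_def assms)
  have d: "\<bar>f x - h x\<bar> \<le> 1" for x using f[of x] h[of x] by linarith
  have D: "\<bar>bip_kernel f x y - bip_kernel h x y\<bar> \<le> 1" for x y
    using bip_kernel_diff_le_1[of f h] f h by blast
  have i: "integrable ?P (\<lambda>(x, y). \<bar>f x - h x\<bar>)" "integrable ?P (\<lambda>(x, y). \<bar>f y - h y\<bar>)"
    using d by (auto intro!: U2.integrable_bounded[of _ 1])
  have i1: "integrable unit_measure (\<lambda>x. \<bar>f x - h x\<bar>)"
    by (rule integrable_unit_le_1) (auto simp: d)
  have "(\<integral>p. \<bar>bip_kernel f (fst p) (snd p) - bip_kernel h (fst p) (snd p)\<bar> \<partial>?P)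
      \<le> (\<integral>p. (\<lambda>(x, y). \<bar>f x - h x\<bar>) p + (\<lambda>(x, y). \<bar>f y - h y\<bar>) p \<partial>?P)"
  proof (rule integral_mono)
    show "integrable ?P (\<lambda>p. \<bar>bip_kernel f (fst p) (snd p) - bip_kernel h (fst p) (snd p)\<bar>)"
      using D by (intro U2.integrable_bounded[of _ 1]) (auto)
    show "\<bar>bip_kernel f (fst p) (snd p) - bip_kernel h (fst p) (snd p)\<bar>
        \<le> (\<lambda>(x, y). \<bar>f x - h x\<bar>) p + (\<lambda>(x, y). \<bar>f y - h y\<bar>) p" for p
      using bip_kernel_diff_le[of f h "fst p" "snd p"] f h by (simp add: split_beta')
  qed (intro Bochner_Integration.integrable_add i)
  also have "\<dots> = (\<integral>(x, y). \<bar>f x - h x\<bar> \<partial>?P) + (\<integral>(x, y). \<bar>f y - h y\<bar> \<partial>?P)"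
    by (rule Bochner_Integration.integral_add) (rule i)+
  also have "\<dots> = 2 * (\<integral>x. \<bar>f x - h x\<bar> \<partial>unit_measure)"
    using U2.integral_fst'[OF i(1)] U2.integral_fst'[OF i(2)] i1 U.prob_space[simplified] by simp
  finally show ?thesis .
qed

lemma integral_threshold_diff:
  assumes "0 \<le> a" "a \<le> 1" "0 \<le> b" "b \<le> 1"
  shows "(\<integral>x. \<bar>indicat_real {..<a} x - indicat_real {..<b} x\<bar> \<partial>unit_measure) = \<bar>a - b\<bar>"
proof -
  have i: "integrable unit_measure (indicat_real {..<c})" for c
    by (rule integrable_unit_le_1) (auto simp: unit_measure_def)
  have *: "(\<integral>x. \<bar>indicat_real {..<a} x - indicat_real {..<b} x\<bar> \<partial>unit_measure) = b - a"
    if "a \<le> b" "0 \<le> a" "b \<le> 1" for a b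
  proof -
    have "\<bar>indicat_real {..<a} x - indicat_real {..<b} x\<bar> = indicat_real {..<b} x - indicat_real {..<a} x" for x
      using that(1) by (auto simp: indicator_def)
    then have "(\<integral>x. \<bar>indicat_real {..<a} x - indicat_real {..<b} x\<bar> \<partial>unit_measure)
        = (\<integral>x. indicat_real {..<b} x - indicat_real {..<a} x \<partial>unit_measure)" by (simp only:)
    also have "\<dots> = b - a"
      unfolding Bochner_Integration.integral_diff[OF i i]
      using that by (simp only: expectation_indicator_lessThan)
    finally show ?thesis .
  qed
  show ?thesis
  proof (cases "a \<le> b")
    case False
    have "\<bar>indicat_real {..<a} x - indicat_real {..<b} x\<bar> = \<bar>indicat_real {..<b} x - indicat_real {..<a} x\<bar>" for x
      by (rule abs_minus_commute)
    then show ?thesis using *[of b a] False assms by (simp only:)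
  qed (use *[of a b] assms in simp)
qed

text \<open>Rounding costs the smaller of \<open>t\<close> and \<open>1 - t\<close>, and the larger
  one is at least 1/2.\<close>

lemma abs_threshold_le:
  assumes "0 \<le> t" "t \<le> (1 :: real)"
  shows "\<bar>t - (if 1/2 \<le> t then 1 else 0)\<bar> \<le> 2 * (t * (1 - t))"
proof (cases "1/2 \<le> t")
  case True
  then have "1 * (1 - t) \<le> (2 * t) * (1 - t)" using assms by (intro mult_right_mono) auto
  then show ?thesis using True assms by simp
next
  case False
  then have "t * 1 \<le> t * (2 * (1 - t))" using assms by (intro mult_left_mono) auto
  then show ?thesis using False assms by (simp add: algebra_simps)
qed

section \<open>From wedge density to cut distance\<close>

text \<open>The chain runs from \<open>W\<close> to \<open>bip_kernel f\<close>, then to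
  \<open>bip_kernel h\<close> for a union of blocks, which \<open>\<phi>\<close> identifies with
  \<open>split_kernel c\<close>, and finally to \<open>W_bip\<close>. The constant rounds up
  \<open>22537 + 22532\<close>.\<close>

lemma cut_dist_W_bip_le:
  assumes W: "graphon W" and "1/4 - \<delta>\<^sup>2 \<le> ind_wedge_density W" and \<delta>: "0 < \<delta>" "\<delta> \<le> 1/4"
  shows "cut_dist W W_bip \<le> 50000 * \<delta>"
proof -
  let ?P = "unit_measure \<Otimes>\<^sub>M unit_measure" and ?U = "unit_measure"
  obtain V where V: "borel_version W V" using borel_version_exists[OF W] .
  interpret V: symmetric_kernel unit_measure V using V by (simp add: borel_version_def)
  obtain f where fm: "f \<in> borel_measurable ?U" and f: "\<And>x. 0 \<le> f x \<and> f x \<le> 1"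
    and f_mean: "\<bar>U.expectation f - 1/2\<bar> \<le> \<delta>"
    and f_L1: "(\<integral>(x, y). \<bar>V x y - bip_kernel f x y\<bar> \<partial>?P) \<le> 7 * \<delta>"
    and f_var: "(\<integral>x. f x * (1 - f x) \<partial>?U) \<le> 5632 * \<delta>"
  proof (rule V.near_bipartite[of \<delta>])
    show "1/4 - \<delta>\<^sup>2 \<le> V.wedge" using assms(2) ind_wedge_density_borel_version[OF V] by simp
  qed (use \<delta> in auto)
  have [measurable]: "f \<in> borel_measurable borel" using fm by (simp add: unit_measure_def)
  define A where "A = {x. 1/2 \<le> f x}"
  have "{x \<in> space borel. 1/2 \<le> f x} \<in> sets borel" by measurable
  then have Am[measurable]: "A \<in> sets borel" by (simp add: A_def)
  obtain n S where n: "0 < n" "S \<subseteq> {..<n}"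
    and AS: "(\<integral>x. \<bar>indicat_real A x - indicat_real (blocks n S) x\<bar> \<partial>?U) \<le> \<delta>"
    using block_approximation[OF Am \<delta>(1)] by blast
  define h where "h = indicat_real (blocks n S)"
  have hm[measurable]: "h \<in> borel_measurable borel" unfolding h_def by measurable
  have h: "0 \<le> h x \<and> h x \<le> 1" for x by (simp add: h_def indicator_unit)
  obtain \<phi> c where \<phi>: "\<phi> \<in> mp_bijections" and c: "0 \<le> c" "c \<le> 1"
    and \<phi>c: "\<And>x. x \<in> \<I> \<Longrightarrow> \<phi> x < c \<longleftrightarrow> nat \<lfloor>real n * x\<rfloor> \<in> S"
    using rearrange_blocks[OF n] by blast
  have h\<phi>: "h x = indicator {..<c} (\<phi> x)" if "x \<in> \<I>" for x
    using \<phi>c[OF that] by (simp add: h_def indicator_def blocks_def)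

  have i: "integrable ?U g" if "g \<in> borel_measurable borel" "\<And>x. 0 \<le> g x \<and> g x \<le> 1" for g :: "real \<Rightarrow> real"
    using that by (intro integrable_unit_le_1) (auto simp: unit_measure_def abs_le_iff order_trans[of _ 0])
  have iA: "integrable ?U (indicat_real A)" by (rule i) (auto simp: indicator_unit)
  have fvi: "integrable ?U (\<lambda>x. f x * (1 - f x))"
    using f by (intro i mult_unit_interval) auto
  have "(\<integral>x. \<bar>f x - h x\<bar> \<partial>?U) \<le> (\<integral>x. 2 * (f x * (1 - f x)) + \<bar>indicat_real A x - h x\<bar> \<partial>?U)"
  proof (rule integral_mono)
    show "\<bar>f x - h x\<bar> \<le> 2 * (f x * (1 - f x)) + \<bar>indicat_real A x - h x\<bar>" for x
    proof -
      have "indicat_real A x = (if 1/2 \<le> f x then 1 else 0)" by (simp add: A_def indicator_def)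
      then have "\<bar>f x - indicat_real A x\<bar> \<le> 2 * (f x * (1 - f x))"
        using abs_threshold_le[of "f x"] f[of x] by (simp only:)
      then show ?thesis by linarith
    qed
  qed (intro integrable_abs Bochner_Integration.integrable_add Bochner_Integration.integrable_diff
        integrable_mult_right fvi iA i[OF \<open>f \<in> borel_measurable borel\<close> f] i[OF hm h])+
  also have "\<dots> = 2 * (\<integral>x. f x * (1 - f x) \<partial>?U) + (\<integral>x. \<bar>indicat_real A x - h x\<bar> \<partial>?U)"
    by (subst Bochner_Integration.integral_add)
       (intro integrable_abs Bochner_Integration.integrable_diff integrable_mult_right fvi iA i[OF hm h] | simp)+
  \<comment> \<open>Rounding \<open>f\<close> at 1/2 costs \<open>2 * 5632 * \<delta>\<close>, and
    the block approximation one more \<open>\<delta>\<close>.\<close>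
  also have "\<dots> \<le> 11265 * \<delta>" using f_var AS by (simp add: h_def)
  finally have fh: "(\<integral>x. \<bar>f x - h x\<bar> \<partial>?U) \<le> 11265 * \<delta>" .

  note bk = bounded_kernel_graphon[OF W] bounded_kernel_graphon[OF graphon_bip_kernel[OF hm h]]
    bounded_kernel_comp[OF bounded_kernel_graphon[OF graphon_W_bip] \<phi>]
  have sp: "graphon (split_kernel c)"
    unfolding split_kernel_def by (rule graphon_bip_kernel) (auto simp: indicator_unit)
  have "cut_dist W W_bip \<le> cut_norm (\<lambda>x y. W x y - W_bip (\<phi> x) (\<phi> y))"
    unfolding cut_dist_def by (rule cINF_lower[OF cut_dist_bdd_below[OF W graphon_W_bip] \<phi>])
  also have "\<dots> \<le> cut_norm (\<lambda>x y. W x y - bip_kernel h x y)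
      + cut_norm (\<lambda>x y. bip_kernel h x y - W_bip (\<phi> x) (\<phi> y))"
    by (rule cut_norm_triangle[OF bk])
  also have "cut_norm (\<lambda>x y. bip_kernel h x y - W_bip (\<phi> x) (\<phi> y)) \<le> 22532 * \<delta>"
  proof -
    have "cut_norm (\<lambda>x y. bip_kernel h x y - W_bip (\<phi> x) (\<phi> y))
        = cut_norm (\<lambda>x y. split_kernel c (\<phi> x) (\<phi> y) - W_bip (\<phi> x) (\<phi> y))"
      by (rule cut_norm_cong) (simp add: split_kernel_def bip_kernel_def h\<phi>)
    also have "\<dots> \<le> cut_norm (\<lambda>x y. split_kernel c x y - W_bip x y)"
      by (rule cut_norm_mp_bijection_le[OF bounded_kernel_diff[OF
            bounded_kernel_graphon[OF sp] bounded_kernel_graphon[OF graphon_W_bip]] \<phi>])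
    also have "\<dots> \<le> (\<integral>p. \<bar>split_kernel c (fst p) (snd p) - split_kernel (1/2) (fst p) (snd p)\<bar> \<partial>?P)"
    proof (rule cut_norm_le_L1)
      show "bounded_kernel (\<lambda>x y. split_kernel c x y - W_bip x y)"
        by (intro bounded_kernel_diff bounded_kernel_graphon sp graphon_W_bip)
      have [measurable]: "indicat_real {..<c} \<in> borel_measurable ?U" for c by (simp add: unit_measure_def)
      show "(\<lambda>p. split_kernel c (fst p) (snd p) - split_kernel (1/2) (fst p) (snd p)) \<in> borel_measurable ?P"
        unfolding split_kernel_def by measurable
      have "AE (x, y) in ?P. W_bip x y = split_kernel (1/2) x y"
        using borel_version_W_bip by (simp add: borel_version_def)
      then show "AE p in ?P. (case p of (x, y) \<Rightarrow> split_kernel c x y - W_bip x y)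
          = split_kernel c (fst p) (snd p) - split_kernel (1/2) (fst p) (snd p)"
        by eventually_elim auto
    qed
    also have "\<dots> \<le> 2 * (\<integral>x. \<bar>indicat_real {..<c} x - indicat_real {..<1/2} x\<bar> \<partial>?U)"
      unfolding split_kernel_def by (rule bip_kernel_L1_le) (auto simp: indicator_unit)
    also have "\<dots> = 2 * \<bar>c - 1/2\<bar>" using c by (subst integral_threshold_diff) auto
    also have "\<bar>c - 1/2\<bar> \<le> 11266 * \<delta>"
    proof -
      \<comment> \<open>As \<open>\<phi>\<close> preserves measure, \<open>c\<close> is the mean of
        \<open>h\<close>; this is close to the mean of \<open>f\<close>, which is within
        \<open>\<delta>\<close> of 1/2.\<close>
      have "c = U.expectation h"
      proof -
        have cI: "emeasure lebesgue ({..<c} \<inter> \<I>) = ennreal c"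
        proof -
          have "{..<c} \<inter> \<I> = {0..<c}" using c by auto
          then show ?thesis using c by simp
        qed
        have "emeasure lebesgue (\<phi> -` ({..<c} \<inter> \<I>) \<inter> \<I>) = ennreal c"
          using mp_bijections_vimage(2)[OF \<phi>, of "{..<c} \<inter> \<I>"] cI by (simp del: emeasure_completion)
        also have "\<phi> -` ({..<c} \<inter> \<I>) \<inter> \<I> = blocks n S \<inter> \<I>"
          using \<phi> \<phi>c by (auto simp: mp_bijections_def bij_betw_def blocks_def)
        finally have "emeasure lborel (blocks n S \<inter> \<I>) = ennreal c" by simp
        then have "emeasure ?U (blocks n S) = ennreal c"
          by (simp add: unit_measure_def emeasure_density indicator_inter_arith[symmetric] Int_commute)
        then have "measure ?U (blocks n S) = c" using c by (simp only: measure_def enn2real_ennreal)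
        then show ?thesis unfolding h_def by (simp only: Bochner_Integration.integral_indicator space_unit_measure Int_UNIV_right)
      qed
      then have "\<bar>c - U.expectation f\<bar> = \<bar>\<integral>x. h x - f x \<partial>?U\<bar>"
        by (simp only: Bochner_Integration.integral_diff[OF i[OF hm h] i[OF \<open>f \<in> borel_measurable borel\<close> f]])
      also have "\<dots> \<le> (\<integral>x. \<bar>h x - f x\<bar> \<partial>?U)" by (rule integral_abs_bound)
      also have "\<dots> \<le> 11265 * \<delta>" using fh by (simp only: abs_minus_commute)
      finally show ?thesis using f_mean by linarith
    qed
    finally show ?thesis by simp
  qed
  also have "cut_norm (\<lambda>x y. W x y - bip_kernel h x y) \<le> 22537 * \<delta>"
  proof -
    have Vf: "\<bar>V x y - bip_kernel g x y\<bar> \<le> 1" if "\<And>x. 0 \<le> g x \<and> g x \<le> 1" for g x y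
      using bip_kernel_unit[of g x y, OF that] V.unit_bounds[of x y] by linarith
    have [measurable]: "h \<in> borel_measurable ?U" by (simp add: unit_measure_def)
    have if1: "integrable ?P (\<lambda>(x, y). \<bar>V x y - bip_kernel f x y\<bar>)"
      using Vf[of f] f fm by (auto intro!: U2.integrable_bounded[of _ 1] simp: split_beta')
    have if2: "integrable ?P (\<lambda>p. \<bar>bip_kernel f (fst p) (snd p) - bip_kernel h (fst p) (snd p)\<bar>)"
      using fm bip_kernel_diff_le_1[of f h] f h by (intro U2.integrable_bounded[of _ 1]) auto
    have "cut_norm (\<lambda>x y. W x y - bip_kernel h x y) \<le> (\<integral>p. \<bar>V (fst p) (snd p) - bip_kernel h (fst p) (snd p)\<bar> \<partial>?P)"
    proof (rule cut_norm_le_L1)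
      show "bounded_kernel (\<lambda>x y. W x y - bip_kernel h x y)" by (intro bounded_kernel_diff bk)
      show "(\<lambda>p. V (fst p) (snd p) - bip_kernel h (fst p) (snd p)) \<in> borel_measurable ?P" by measurable
      have "AE (x, y) in ?P. W x y = V x y" using V by (simp add: borel_version_def)
      then show "AE p in ?P. (case p of (x, y) \<Rightarrow> W x y - bip_kernel h x y) = V (fst p) (snd p) - bip_kernel h (fst p) (snd p)"
        by eventually_elim auto
    qed
    also have "\<dots> \<le> (\<integral>p. (\<lambda>(x, y). \<bar>V x y - bip_kernel f x y\<bar>) p + \<bar>bip_kernel f (fst p) (snd p) - bip_kernel h (fst p) (snd p)\<bar> \<partial>?P)"
    proof (rule integral_mono)
      show "integrable ?P (\<lambda>p. \<bar>V (fst p) (snd p) - bip_kernel h (fst p) (snd p)\<bar>)"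
        using Vf h by (intro U2.integrable_bounded[of _ 1]) auto
      show "integrable ?P (\<lambda>p. (\<lambda>(x, y). \<bar>V x y - bip_kernel f x y\<bar>) p + \<bar>bip_kernel f (fst p) (snd p) - bip_kernel h (fst p) (snd p)\<bar>)"
        by (intro Bochner_Integration.integrable_add if1 if2)
    qed (auto simp: split_beta')
    also have "\<dots> = (\<integral>(x, y). \<bar>V x y - bip_kernel f x y\<bar> \<partial>?P)
        + (\<integral>p. \<bar>bip_kernel f (fst p) (snd p) - bip_kernel h (fst p) (snd p)\<bar> \<partial>?P)"
      by (intro Bochner_Integration.integral_add if1 if2)
    also have "\<dots> \<le> 7 * \<delta> + 2 * (11265 * \<delta>)"
      using f_L1 fh bip_kernel_L1_le[OF \<open>f \<in> borel_measurable borel\<close> hm f h] by (intro add_mono) auto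
    finally show ?thesis by simp
  qed
  finally show ?thesis using \<delta>(1) by simp
qed

text \<open>A maximizer does at least as well as \<open>W_bip\<close>, and both objectives are
  within \<open>\<bar>\<beta>1\<bar> + 1\<close> of \<open>\<beta>2\<close> times the wedge density.
  The density deficit is thus at most \<open>2 * (\<bar>\<beta>1\<bar> + 1) / \<beta>2\<close>,
  taken as \<open>\<delta>\<^sup>2\<close>; the lower bound on \<open>\<beta>2\<close> says that
  \<open>\<delta> \<le> 1/4\<close>.\<close>

lemma class_dist_maximizer_le:
  assumes C: "C \<in> maximizers_wedge \<beta>1 \<beta>2" and \<beta>: "32 * (\<bar>\<beta>1\<bar> + 1) \<le> \<beta>2"
  shows "class_dist C (graphon_class W_bip) \<le> 50000 * sqrt (2 * (\<bar>\<beta>1\<bar> + 1) / \<beta>2)"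
proof -
  obtain W where W: "W \<in> C" "\<And>U. graphon U \<Longrightarrow> wedge_objective \<beta>1 \<beta>2 U \<le> wedge_objective \<beta>1 \<beta>2 W"
    and CS: "C \<in> graphon_space"
    using C unfolding maximizers_wedge_def Union_graphon_space by auto
  have gW: "graphon W" using W(1) CS Union_graphon_space by auto
  have "C = graphon_class W"
  proof -
    obtain a where "C = graphon_rel `` {a}" using CS unfolding graphon_space_def by (rule quotientE)
    with W(1) show ?thesis
      unfolding graphon_class_def using equiv_class_eq[OF equiv_graphon_rel, of a W] by auto
  qed
  then have e: "class_dist C (graphon_class W_bip) = cut_dist W W_bip"
    using class_dist_graphon_class[OF gW graphon_W_bip] by simp
  have "0 < 32 * (\<bar>\<beta>1\<bar> + 1)" by (simp add: add_nonneg_pos)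
  then have \<beta>0: "0 < \<beta>2" using \<beta> by (rule less_le_trans)
  define \<delta> where "\<delta> = sqrt (2 * (\<bar>\<beta>1\<bar> + 1) / \<beta>2)"
  have \<delta>2: "\<delta>\<^sup>2 = 2 * (\<bar>\<beta>1\<bar> + 1) / \<beta>2" using \<beta>0 by (simp add: \<delta>_def)
  have "0 < \<delta>" using \<beta>0 by (simp add: \<delta>_def add_nonneg_pos)
  have "\<delta> \<le> 1/4"
  proof (rule power2_le_imp_le)
    show "\<delta>\<^sup>2 \<le> (1/4)\<^sup>2" unfolding \<delta>2 using \<beta> \<beta>0 by (simp add: power2_eq_square pos_divide_le_eq)
  qed simp
  have "\<beta>2 / 4 - (\<bar>\<beta>1\<bar> + 1) \<le> \<beta>2 * ind_wedge_density W + (\<bar>\<beta>1\<bar> + 1)"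
    using wedge_objective_W_bip_ge[of \<beta>2 \<beta>1] W(2)[OF graphon_W_bip] wedge_objective_bounds[OF gW, of \<beta>1 \<beta>2]
    by linarith
  then have "(\<beta>2 / 4 - 2 * (\<bar>\<beta>1\<bar> + 1)) / \<beta>2 \<le> ind_wedge_density W"
    using \<beta>0 by (simp add: pos_divide_le_eq mult.commute)
  then have "1/4 - \<delta>\<^sup>2 \<le> ind_wedge_density W"
    unfolding \<delta>2 using \<beta>0 by (simp add: diff_divide_distrib)
  from cut_dist_W_bip_le[OF gW this \<open>0 < \<delta>\<close> \<open>\<delta> \<le> 1/4\<close>] show ?thesis
    unfolding e \<delta>_def .
qed

theorem theorem3p28:
  fixes \<beta>1 :: real
  shows "((\<lambda>\<beta>2. SUP C \<in> maximizers_wedge \<beta>1 \<beta>2.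
             ennreal (class_dist C (graphon_class W_bip))) \<longlongrightarrow> 0) at_top \<and>
         ((\<lambda>\<beta>2. psi_wedge \<beta>1 \<beta>2 / \<beta>2) \<longlongrightarrow> 1 / 4) at_top"
proof
  let ?b = "\<lambda>\<beta>2. 50000 * sqrt (2 * (\<bar>\<beta>1\<bar> + 1) / \<beta>2)"
  show "((\<lambda>\<beta>2. SUP C \<in> maximizers_wedge \<beta>1 \<beta>2.
             ennreal (class_dist C (graphon_class W_bip))) \<longlongrightarrow> 0) at_top"
  \<comment> \<open>In \<open>ennreal\<close> the lower bound 0 is automatic, and a bound on each
    term bounds the supremum even over an empty set of maximizers.\<close>
  proof (rule tendsto_sandwich)
    show "((\<lambda>_. 0 :: ennreal) \<longlongrightarrow> 0) at_top" by simp
    show "\<forall>\<^sub>F \<beta>2 in at_top. (SUP C \<in> maximizers_wedge \<beta>1 \<beta>2.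
        ennreal (class_dist C (graphon_class W_bip))) \<le> ennreal (?b \<beta>2)"
      using eventually_ge_at_top[of "32 * (\<bar>\<beta>1\<bar> + 1)"]
      by eventually_elim (intro SUP_least ennreal_leI class_dist_maximizer_le)
    have "((\<lambda>\<beta>2. 2 * (\<bar>\<beta>1\<bar> + 1) / \<beta>2) \<longlongrightarrow> 0) at_top"
      by (rule tendsto_divide_0[OF tendsto_const filterlim_at_top_imp_at_infinity[OF filterlim_ident]])
    then have "(?b \<longlongrightarrow> 50000 * sqrt 0) at_top" by (intro tendsto_intros)
    then show "((\<lambda>\<beta>2. ennreal (?b \<beta>2)) \<longlongrightarrow> 0) at_top"
      using tendsto_ennrealI by fastforce
  qed simp
qed (rule psi_wedge_limit)

end
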